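(* Let $X$ be a compact metric space, $f:X\to X$ a continuous map and $\varphi:X\to\mathbb{R}$ a continuous function. For any ergodic $f$-invariant Borel probability measure $\mu$ on $X$, the quantities $SP_\mu(f,\varphi)$ and $SP'_\mu(f,\varphi)$ exist (that is, $\underline{SP}_\mu(f,\varphi)=\overline{SP}_\mu(f,\varphi)$ and $\underline{SP}'_\mu(f,\varphi)=\overline{SP}'_\mu(f,\varphi)$), and $$SP_\mu(f,\varphi)=SP'_\mu(f,\varphi)=h_\mu(f)+\int_X\varphi\,d\mu .$$
   Context: Let $d$ be the metric on $X$, $d_n(x,y)=\max\{d(f^ix,f^iy):0\le i<n\}$, $S_n\varphi(x)=\sum_{i=0}^{n-1}\varphi(f^ix)$, and $h_\mu(f)$ the Kolmogorov–Sinai entropy. $\mathcal{M}(X)$ is the space of Borel probability measures on $X$ with the weak-star topology. A set $E\subset X$ is $(n,\epsilon)$-separated if $d_n(x,y)>\epsilon$ for all distinct $x,y\in E$. For $\delta>0$, a set $A\subset X$ is $(\delta,n,\epsilon)$-separated if $\#\{j:0\le j\le n-1,\ d(f^jx,f^jy)>\epsilon\}\ge\delta n$ for all distinct $x,y\in A$. Let $\mathcal{E}_n(x)=\frac1n\sum_{k=0}^{n-1}\delta_{f^kx}$ and, for $F\subset\mathcal{M}(X)$, $X_{n,F}=\{x\in X:\mathcal{E}_n(x)\in F\}$. Define $$P(F;\varphi,n,\epsilon)=\sup\Big\{\sum_{x\in E}e^{S_n\varphi(x)}:E\subset X_{n,F}\text{ is }(n,\epsilon)\text{-separated}\Big\},$$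 and $P(F;\varphi,\delta,n,\epsilon)$ likewise with $(\delta,n,\epsilon)$-separated sets in place of $(n,\epsilon)$-separated sets. With the infimum over neighbourhoods $F$ of $\mu$ in $\mathcal{M}(X)$ (equivalently, over any base of neighbourhoods of $\mu$), define $$\overline{SP}_\mu(f,\varphi)=\lim_{\epsilon\to0}\inf_{F\ni\mu}\limsup_{n\to\infty}\frac1n\log P(F;\varphi,n,\epsilon),\qquad \underline{SP}_\mu(f,\varphi)=\lim_{\epsilon\to0}\inf_{F\ni\mu}\liminf_{n\to\infty}\frac1n\log P(F;\varphi,n,\epsilon),$$ $$\overline{SP}'_\mu(f,\varphi)=\lim_{\epsilon\to0}\lim_{\delta\to0}\inf_{F\ni\mu}\limsup_{n\to\infty}\frac1n\log P(F;\varphi,\delta,n,\epsilon),\qquad \underline{SP}'_\mu(f,\varphi)=\lim_{\epsilon\to0}\lim_{\delta\to0}\inf_{F\ni\mu}\liminf_{n\to\infty}\frac1n\log P(F;\varphi,\delta,n,\epsilon).$$ When the upper and lower quantities coincide, the common values are denoted $SP_\mu(f,\varphi)$ and $SP'_\mu(f,\varphi)$ respectively. *)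

theory Defs
  imports "HOL-Probability.Probability"
begin

section \<open>Invariant measures and the weak-star topology\<close>

text \<open>The phase space is a type \<open>'a\<close> of class \<^class>\<open>metric_space\<close>; its compactness is assumed
  explicitly where it is needed.\<close>

definition borel_probs :: "'a::topological_space measure set" where
  "borel_probs = {\<mu>. sets \<mu> = sets borel \<and> prob_space \<mu>}"

definition invariant_measure :: "('a::topological_space \<Rightarrow> 'a) \<Rightarrow> 'a measure \<Rightarrow> bool" where
  "invariant_measure f \<mu> \<longleftrightarrow> \<mu> \<in> borel_probs \<and> f \<in> borel_measurable borel \<and> distr \<mu> borel f = \<mu>"

definition ergodic_measure :: "('a::topological_space \<Rightarrow> 'a) \<Rightarrow> 'a measure \<Rightarrow> bool" where
  "ergodic_measure f \<mu> \<longleftrightarrow> invariant_measure f \<mu> \<and>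
     (\<forall>A \<in> sets borel. f -` A = A \<longrightarrow> measure \<mu> A = 0 \<or> measure \<mu> A = 1)"

text \<open>The coarsest topology making \<open>\<nu> \<mapsto> \<integral>g d\<nu>\<close> continuous for every continuous \<open>g\<close>. On a compact
  space such \<open>g\<close> are automatically bounded.\<close>

definition weak_star_topology :: "'a::topological_space measure topology" where
  "weak_star_topology = topology_generated_by
     {{\<nu> \<in> borel_probs. (\<integral>x. g x \<partial>\<nu>) \<in> U} | (g :: 'a \<Rightarrow> real) U. continuous_on UNIV g \<and> open U}"

definition nbhds_of :: "'a::topological_space measure \<Rightarrow> 'a measure set set" where
  "nbhds_of \<mu> = {F. F \<subseteq> borel_probs \<and> (\<exists>U. openin weak_star_topology U \<and> \<mu> \<in> U \<and> U \<subseteq> F)}"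


section \<open>Kolmogorov--Sinai entropy\<close>

definition finite_borel_partition :: "'a::topological_space set set \<Rightarrow> bool" where
  "finite_borel_partition \<xi> \<longleftrightarrow> finite \<xi> \<and> \<xi> \<subseteq> sets borel \<and> partition_on UNIV \<xi>"

text \<open>Since \<open>ln 0 = 0\<close>, the convention \<open>0 log 0 = 0\<close> is built in.\<close>

definition partition_entropy :: "'a measure \<Rightarrow> 'a set set \<Rightarrow> real" where
  "partition_entropy \<mu> \<xi> = - (\<Sum>A\<in>\<xi>. measure \<mu> A * ln (measure \<mu> A))"

definition iterated_join :: "('a \<Rightarrow> 'a) \<Rightarrow> 'a set set \<Rightarrow> nat \<Rightarrow> 'a set set" where
  "iterated_join f \<xi> n =
     common_refinement ((\<lambda>i. (\<lambda>A. (f ^^ i) -` A) ` \<xi> - {{}}) ` {..<n})"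

definition entropy_wrt_partition :: "'a measure \<Rightarrow> ('a \<Rightarrow> 'a) \<Rightarrow> 'a set set \<Rightarrow> real" where
  "entropy_wrt_partition \<mu> f \<xi> = lim (\<lambda>n. partition_entropy \<mu> (iterated_join f \<xi> n) / real n)"

definition KS_entropy :: "'a::topological_space measure \<Rightarrow> ('a \<Rightarrow> 'a) \<Rightarrow> ereal" where
  "KS_entropy \<mu> f = (SUP \<xi> \<in> {\<xi>. finite_borel_partition \<xi>}. ereal (entropy_wrt_partition \<mu> f \<xi>))"


section \<open>Empirical measures and separated sets\<close>

definition empirical_measure :: "('a::topological_space \<Rightarrow> 'a) \<Rightarrow> nat \<Rightarrow> 'a \<Rightarrow> 'a measure" where
  "empirical_measure f n x = measure_of UNIV (sets borel)
     (\<lambda>A. (\<Sum>k<n. emeasure (return borel ((f ^^ k) x)) A) / of_nat n)"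

text \<open>\<^const>\<open>measure_of\<close> yields the null measure unless the given set function is a measure; here it is one.\<close>

lemma space_empirical_measure [simp]: "space (empirical_measure f n x) = UNIV"
  by (simp add: empirical_measure_def space_measure_of_conv)

lemma sets_empirical_measure [simp]: "sets (empirical_measure f n x) = sets borel"
  unfolding empirical_measure_def
  using sets.sets_measure_of_eq[of borel] by (simp add: sets_measure_of_conv)

lemma emeasure_empirical_measure:
  assumes "A \<in> sets borel"
  shows "emeasure (empirical_measure f n x) A = (\<Sum>k<n. indicator A ((f ^^ k) x)) / of_nat n"
proof -
  let ?m = "\<lambda>A. (\<Sum>k<n. emeasure (return borel ((f ^^ k) x)) A) / of_nat n"
  have "countably_additive (sets (empirical_measure f n x)) ?m"
  proof (rule countably_additiveI)
    fix B :: "nat \<Rightarrow> 'a set"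
    assume B: "range B \<subseteq> sets (empirical_measure f n x)" "disjoint_family B"
    have "(\<Sum>i. ?m (B i)) = (\<Sum>i. \<Sum>k<n. emeasure (return borel ((f ^^ k) x)) (B i)) / of_nat n"
      by (simp add: divide_ennreal_def)
    also have "\<dots> = (\<Sum>k<n. \<Sum>i. emeasure (return borel ((f ^^ k) x)) (B i)) / of_nat n"
      by (simp add: suminf_sum summableI)
    also have "\<dots> = ?m (\<Union>i. B i)"
      using B by (simp add: suminf_emeasure del: emeasure_return)
    finally show "(\<Sum>i. ?m (B i)) = ?m (\<Union>i. B i)" .
  qed
  then have "emeasure (empirical_measure f n x) A = ?m A"
    by (intro emeasure_measure_of[OF empirical_measure_def])
      (use assms in \<open>auto simp: positive_def\<close>)
  with assms show ?thesis
    by simp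
qed

definition empirical_in :: "('a::topological_space \<Rightarrow> 'a) \<Rightarrow> nat \<Rightarrow> 'a measure set \<Rightarrow> 'a set" where
  "empirical_in f n F = {x. empirical_measure f n x \<in> F}"

definition birkhoff_sum :: "('a \<Rightarrow> 'a) \<Rightarrow> ('a \<Rightarrow> real) \<Rightarrow> nat \<Rightarrow> 'a \<Rightarrow> real" where
  "birkhoff_sum f \<phi> n x = (\<Sum>i<n. \<phi> ((f ^^ i) x))"

text \<open>Only \<open>n \<ge> 1\<close> is meaningful here; the value at \<open>n = 0\<close> does not affect any limit below.\<close>

definition bowen_dist :: "('a::metric_space \<Rightarrow> 'a) \<Rightarrow> nat \<Rightarrow> 'a \<Rightarrow> 'a \<Rightarrow> real" where
  "bowen_dist f n x y = Max ((\<lambda>i. dist ((f ^^ i) x) ((f ^^ i) y)) ` {..<n})"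

definition separated :: "('a::metric_space \<Rightarrow> 'a) \<Rightarrow> nat \<Rightarrow> real \<Rightarrow> 'a set \<Rightarrow> bool" where
  "separated f n \<epsilon> E \<longleftrightarrow> (\<forall>x\<in>E. \<forall>y\<in>E. x \<noteq> y \<longrightarrow> bowen_dist f n x y > \<epsilon>)"

definition delta_separated ::
    "('a::metric_space \<Rightarrow> 'a) \<Rightarrow> real \<Rightarrow> nat \<Rightarrow> real \<Rightarrow> 'a set \<Rightarrow> bool" where
  "delta_separated f \<delta> n \<epsilon> E \<longleftrightarrow> (\<forall>x\<in>E. \<forall>y\<in>E. x \<noteq> y \<longrightarrow>
     real (card {j. j < n \<and> dist ((f ^^ j) x) ((f ^^ j) y) > \<epsilon>}) \<ge> \<delta> * real n)"


section \<open>The pressures SP and SP'\<close>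

text \<open>Restricting to finite \<open>E\<close> loses nothing: subsets of separated sets are separated, so the supremum
  over finite \<open>E\<close> agrees with the one over all \<open>E\<close> (and in a compact space, for \<open>n \<ge> 1\<close>,
  separated sets are finite). Without it, \<^const>\<open>sum\<close> would be \<open>0\<close> on infinite sets.\<close>

definition P_sep :: "('a::metric_space \<Rightarrow> 'a) \<Rightarrow> 'a measure set \<Rightarrow> ('a \<Rightarrow> real) \<Rightarrow> nat \<Rightarrow> real \<Rightarrow> ennreal" where
  "P_sep f F \<phi> n \<epsilon> =
     (SUP E \<in> {E. finite E \<and> E \<subseteq> empirical_in f n F \<and> separated f n \<epsilon> E}.
        \<Sum>x\<in>E. ennreal (exp (birkhoff_sum f \<phi> n x)))"

definition P_delta_sep ::
    "('a::metric_space \<Rightarrow> 'a) \<Rightarrow> 'a measure set \<Rightarrow> ('a \<Rightarrow> real) \<Rightarrow> real \<Rightarrow> nat \<Rightarrow> real \<Rightarrow> ennreal" where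
  "P_delta_sep f F \<phi> \<delta> n \<epsilon> =
     (SUP E \<in> {E. finite E \<and> E \<subseteq> empirical_in f n F \<and> delta_separated f \<delta> n \<epsilon> E}.
        \<Sum>x\<in>E. ennreal (exp (birkhoff_sum f \<phi> n x)))"

text \<open>The logarithm on \<open>[0, \<infinity>]\<close>; note that \<open>P_sep\<close> is \<open>0\<close> when \<open>empirical_in f n F\<close> is empty.\<close>

definition ext_ln :: "ennreal \<Rightarrow> ereal" where
  "ext_ln x = (if x = 0 then - \<infinity> else if x = \<top> then \<infinity> else ereal (ln (enn2real x)))"

definition upper_SP :: "'a::metric_space measure \<Rightarrow> ('a \<Rightarrow> 'a) \<Rightarrow> ('a \<Rightarrow> real) \<Rightarrow> ereal" where
  "upper_SP \<mu> f \<phi> = Lim (at_right 0) (\<lambda>\<epsilon>. INF F\<in>nbhds_of \<mu>.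
     limsup (\<lambda>n. ereal (1 / real n) * ext_ln (P_sep f F \<phi> n \<epsilon>)))"

definition lower_SP :: "'a::metric_space measure \<Rightarrow> ('a \<Rightarrow> 'a) \<Rightarrow> ('a \<Rightarrow> real) \<Rightarrow> ereal" where
  "lower_SP \<mu> f \<phi> = Lim (at_right 0) (\<lambda>\<epsilon>. INF F\<in>nbhds_of \<mu>.
     liminf (\<lambda>n. ereal (1 / real n) * ext_ln (P_sep f F \<phi> n \<epsilon>)))"

definition upper_SP' :: "'a::metric_space measure \<Rightarrow> ('a \<Rightarrow> 'a) \<Rightarrow> ('a \<Rightarrow> real) \<Rightarrow> ereal" where
  "upper_SP' \<mu> f \<phi> = Lim (at_right 0) (\<lambda>\<epsilon>. Lim (at_right 0) (\<lambda>\<delta>. INF F\<in>nbhds_of \<mu>.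
     limsup (\<lambda>n. ereal (1 / real n) * ext_ln (P_delta_sep f F \<phi> \<delta> n \<epsilon>))))"

definition lower_SP' :: "'a::metric_space measure \<Rightarrow> ('a \<Rightarrow> 'a) \<Rightarrow> ('a \<Rightarrow> real) \<Rightarrow> ereal" where
  "lower_SP' \<mu> f \<phi> = Lim (at_right 0) (\<lambda>\<epsilon>. Lim (at_right 0) (\<lambda>\<delta>. INF F\<in>nbhds_of \<mu>.
     liminf (\<lambda>n. ereal (1 / real n) * ext_ln (P_delta_sep f F \<phi> \<delta> n \<epsilon>))))"

text \<open>All limits above exist in \<^typ>\<open>ereal\<close>, because the expressions are antitone in \<open>\<epsilon>\<close> and \<open>\<delta>\<close>.\<close>

lemma tendsto_at_right_antimono:
  fixes g :: "real \<Rightarrow> ereal"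
  assumes "\<And>a b. 0 < a \<Longrightarrow> a \<le> b \<Longrightarrow> g b \<le> g a"
  shows "(g \<longlongrightarrow> (SUP a\<in>{0<..}. g a)) (at_right 0)"
proof (rule order_tendstoI)
  fix c assume "c < (SUP a\<in>{0<..}. g a)"
  then obtain b where "0 < b" "c < g b"
    by (auto simp: less_SUP_iff)
  then show "\<forall>\<^sub>F a in at_right 0. c < g a"
    unfolding eventually_at_right_field using assms by (meson less_imp_le less_le_trans)
next
  fix c assume "(SUP a\<in>{0<..}. g a) < c"
  then have "\<And>a. 0 < a \<Longrightarrow> g a < c"
    by (meson SUP_lessD greaterThan_iff)
  then show "\<forall>\<^sub>F a in at_right 0. g a < c"
    by (auto simp: eventually_at_right_field intro: exI[of _ 1])
qed

lemma Lim_at_right_antimono: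
  fixes g :: "real \<Rightarrow> ereal"
  assumes "\<And>a b. 0 < a \<Longrightarrow> a \<le> b \<Longrightarrow> g b \<le> g a"
  shows "Lim (at_right 0) g = (SUP a\<in>{0<..}. g a)"
  by (intro tendsto_Lim tendsto_at_right_antimono assms) simp

lemma ext_ln_mono:
  assumes "x \<le> y" shows "ext_ln x \<le> ext_ln y"
proof (cases "x = 0 \<or> y = \<top>")
  case False
  then have "0 < enn2real x" "enn2real x \<le> enn2real y" "y \<noteq> 0" "x \<noteq> \<top>"
    using assms by (auto simp: enn2real_positive_iff less_top top_unique zero_less_iff_neq_zero
        intro!: enn2real_mono intro: le_less_trans)
  with False show ?thesis
    by (simp add: ext_ln_def)
qed (use assms in \<open>auto simp: ext_ln_def top_unique\<close>)

lemma P_sep_antimono: "a \<le> b \<Longrightarrow> P_sep f F \<phi> n b \<le> P_sep f F \<phi> n a"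
  unfolding P_sep_def separated_def by (rule SUP_subset_mono) (auto, force)

lemma P_delta_sep_antimono:
  assumes "a \<le> b" "c \<le> d"
  shows "P_delta_sep f F \<phi> d n b \<le> P_delta_sep f F \<phi> c n a"
proof -
  have "delta_separated f c n a E" if E: "delta_separated f d n b E" for E
    unfolding delta_separated_def
  proof (intro ballI impI)
    fix x y assume xy: "x \<in> E" "y \<in> E" "x \<noteq> y"
    have "c * real n \<le> d * real n"
      using assms by (simp add: mult_right_mono)
    also have "\<dots> \<le> real (card {j. j < n \<and> b < dist ((f ^^ j) x) ((f ^^ j) y)})"
      using E xy by (simp add: delta_separated_def)
    also have "\<dots> \<le> real (card {j. j < n \<and> a < dist ((f ^^ j) x) ((f ^^ j) y)})"
      unfolding of_nat_le_iff by (rule card_mono) (use assms in auto)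
    finally show "c * real n \<le> real (card {j. j < n \<and> a < dist ((f ^^ j) x) ((f ^^ j) y)})" .
  qed
  then show ?thesis
    unfolding P_delta_sep_def by (intro SUP_subset_mono) auto
qed

lemma SP_eq_SUP:
  "upper_SP \<mu> f \<phi> = (SUP \<epsilon>\<in>{0<..}. INF F\<in>nbhds_of \<mu>.
     limsup (\<lambda>n. ereal (1 / real n) * ext_ln (P_sep f F \<phi> n \<epsilon>)))"
  "lower_SP \<mu> f \<phi> = (SUP \<epsilon>\<in>{0<..}. INF F\<in>nbhds_of \<mu>.
     liminf (\<lambda>n. ereal (1 / real n) * ext_ln (P_sep f F \<phi> n \<epsilon>)))"
  unfolding upper_SP_def lower_SP_def
  by (intro Lim_at_right_antimono INF_mono' Limsup_mono Liminf_mono always_eventually allI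
      ereal_mult_left_mono ext_ln_mono P_sep_antimono; simp)+

lemma SP'_eq_SUP:
  "upper_SP' \<mu> f \<phi> = (SUP \<epsilon>\<in>{0<..}. SUP \<delta>\<in>{0<..}. INF F\<in>nbhds_of \<mu>.
     limsup (\<lambda>n. ereal (1 / real n) * ext_ln (P_delta_sep f F \<phi> \<delta> n \<epsilon>)))" (is "_ = (SUP \<epsilon>\<in>_. SUP \<delta>\<in>_. ?u \<epsilon> \<delta>)")
  "lower_SP' \<mu> f \<phi> = (SUP \<epsilon>\<in>{0<..}. SUP \<delta>\<in>{0<..}. INF F\<in>nbhds_of \<mu>.
     liminf (\<lambda>n. ereal (1 / real n) * ext_ln (P_delta_sep f F \<phi> \<delta> n \<epsilon>)))" (is "_ = (SUP \<epsilon>\<in>_. SUP \<delta>\<in>_. ?l \<epsilon> \<delta>)")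
proof -
  have u: "?u b d \<le> ?u a c" and l: "?l b d \<le> ?l a c" if "a \<le> b" "c \<le> d" for a b c d
    using that
    by (intro INF_mono' Limsup_mono Liminf_mono always_eventually allI ereal_mult_left_mono
        ext_ln_mono P_delta_sep_antimono; simp)+
  have "Lim (at_right 0) (?u \<epsilon>) = (SUP \<delta>\<in>{0<..}. ?u \<epsilon> \<delta>)" for \<epsilon>
    by (intro Lim_at_right_antimono u) auto
  then show "upper_SP' \<mu> f \<phi> = (SUP \<epsilon>\<in>{0<..}. SUP \<delta>\<in>{0<..}. ?u \<epsilon> \<delta>)"
    unfolding upper_SP'_def by (simp only:) (intro Lim_at_right_antimono SUP_mono' u; simp)
  have "Lim (at_right 0) (?l \<epsilon>) = (SUP \<delta>\<in>{0<..}. ?l \<epsilon> \<delta>)" for \<epsilon>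
    by (intro Lim_at_right_antimono l) auto
  then show "lower_SP' \<mu> f \<phi> = (SUP \<epsilon>\<in>{0<..}. SUP \<delta>\<in>{0<..}. ?l \<epsilon> \<delta>)"
    unfolding lower_SP'_def by (simp only:) (intro Lim_at_right_antimono SUP_mono' l; simp)
qed

end

theory Submission
  imports Defs
begin

text \<open>Since \<open>\<delta>\<close>-separated sets are separated, it suffices to bound \<open>upper_SP\<close> from above and
  \<open>lower_SP'\<close> from below by \<open>h + \<integral>\<phi> d\<mu>\<close>, with orbits coded by their names with respect to a finite
  partition.

  Upper bound: take a partition into cells of diameter at most \<open>\<epsilon>\<close> with null boundaries, so that the
  points of a separated set have distinct names. Give every word the weight it has under a
  smoothed Markov chain of memory \<open>m\<close> matching the word frequencies; the total weight is bounded in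
  \<open>n\<close>. The logarithm of the weight is a Birkhoff sum of a bounded, almost everywhere continuous
  function, hence is controlled along every orbit whose empirical measure is close to \<open>\<mu>\<close>, by
  \<open>H\<^sub>m\<^sub>+\<^sub>1 - H\<^sub>m \<approx> h\<close> per step.

  Lower bound: shrink the cells of an arbitrary partition to disjoint compact sets. By the ergodic
  theorem most points have an orbit that is generic for the given neighbourhood of \<open>\<mu>\<close> and
  rarely leaves these compact sets. For a maximal \<open>\<delta>\<close>-separated set \<open>E\<close> of such points, the names of \<open>E\<close> are
  dense in Hamming distance, and the Gibbs inequality turns this into \<open>ln (card E) \<ge> H\<^sub>n - \<eta> n\<close>
  with \<open>\<eta>\<close> arbitrarily small; no pointwise entropy theorem is needed.\<close>

section \<open>Convexity and subadditivity tools\<close>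

text \<open>This is \<open>ln u \<le> u - 1\<close> at \<open>u = W i / (p i * sum W I)\<close>,
  averaged over \<open>p\<close>. The weights are not normalised, which costs the term
  \<open>ln (sum W I)\<close>.\<close>

lemma gibbs_inequality:
  fixes p W :: "'i \<Rightarrow> real"
  assumes "finite I" and p: "\<And>i. i \<in> I \<Longrightarrow> 0 \<le> p i" "sum p I = 1"
    and W: "\<And>i. i \<in> I \<Longrightarrow> 0 \<le> W i" "\<And>i. i \<in> I \<Longrightarrow> 0 < p i \<Longrightarrow> 0 < W i"
  shows "- (\<Sum>i\<in>I. p i * ln (p i)) \<le> - (\<Sum>i\<in>I. p i * ln (W i)) + ln (sum W I)"
proof -
  define t where "t = sum W I"
  obtain j where j: "j \<in> I" "0 < p j"
    using p by (metis less_eq_real_def sum.neutral zero_neq_one)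
  have t: "0 < t"
    unfolding t_def using assms j by (meson sum_pos2)
  have term_le: "p i * ln (W i) - p i * ln (p i) - p i * ln t \<le> W i / t - p i" if i: "i \<in> I" for i
  proof (cases "p i = 0")
    case True then show ?thesis using W(1)[OF i] t by simp
  next
    case False
    then have pi: "0 < p i" "0 < W i" using p(1)[OF i] W(2)[OF i] by auto
    have "ln (W i) - ln (p i) - ln t = ln (W i / (p i * t))"
      using pi t by (simp add: ln_div ln_mult)
    also have "\<dots> \<le> W i / (p i * t) - 1"
      using pi t by (intro ln_le_minus_one) simp
    finally have "p i * (ln (W i) - ln (p i) - ln t) \<le> p i * (W i / (p i * t) - 1)"
      using pi by (intro mult_left_mono) auto
    also have "\<dots> = W i / t - p i"
      using pi t by (simp add: field_simps)
    finally show ?thesis by (simp add: algebra_simps)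
  qed
  have "(\<Sum>i\<in>I. p i * ln (W i)) - (\<Sum>i\<in>I. p i * ln (p i)) - ln t
      = (\<Sum>i\<in>I. p i * ln (W i) - p i * ln (p i) - p i * ln t)"
    using p(2) by (simp add: sum_subtractf flip: sum_distrib_right)
  also have "\<dots> \<le> (\<Sum>i\<in>I. W i / t - p i)"
    by (intro sum_mono term_le)
  also have "\<dots> = 0"
    using t p(2) by (simp add: sum_subtractf t_def flip: sum_divide_distrib)
  finally show ?thesis by (simp add: t_def)
qed

text \<open>Fekete's lemma: for a fixed \<open>m\<close> nearly attaining the infimum, division of
  \<open>n\<close> by \<open>m\<close> leaves a remainder whose contribution is bounded
  independently of \<open>n\<close>.\<close>

lemma subadditive_converges:
  fixes a :: "nat \<Rightarrow> real"
  assumes sub: "\<And>m n. a (m + n) \<le> a m + a n" and nonneg: "\<And>n. 0 \<le> a n"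
  shows "(\<lambda>n. a n / real n) \<longlonglongrightarrow> (INF n\<in>{1..}. a n / real n)"
proof -
  define L where "L = (INF n\<in>{1..}. a n / real n)"
  have bdd: "bdd_below ((\<lambda>n. a n / real n) ` {1..})"
    using nonneg by (intro bdd_belowI[of _ 0]) auto
  have lower: "L \<le> a n / real n" if "1 \<le> n" for n
    unfolding L_def using bdd that by (intro cINF_lower) auto
  have mult: "a (q * m + r) \<le> real q * a m + a r" for q m r
  proof (induction q)
    case (Suc q)
    have "a (Suc q * m + r) \<le> a m + a (q * m + r)"
      using sub[of m "q * m + r"] by (simp add: algebra_simps)
    with Suc show ?case by (simp add: algebra_simps)
  qed simp
  have upper: "\<forall>\<^sub>F n in sequentially. a n / real n < u" if "L < u" for u
  proof -
    have "(\<exists>m\<in>{1..}. a m / real m < u)"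
      using that cINF_less_iff[OF _ bdd, of u] unfolding L_def by (metis atLeast_iff empty_iff order_refl)
    then obtain m where m: "1 \<le> m" "a m / real m < u"
      by (meson atLeast_iff)
    \<comment> \<open>By nonnegativity, the sum over all remainders dominates each of them.\<close>
    define C where "C = (\<Sum>r<m. a r)"
    have C: "a r \<le> C" if "r < m" for r
      unfolding C_def using that nonneg by (intro member_le_sum) auto
    have bound: "a n / real n \<le> a m / real m + C / real n" if "1 \<le> n" for n
    proof -
      have "a n \<le> real (n div m) * a m + a (n mod m)"
        using mult[of "n div m" m "n mod m"] by simp
      also have "\<dots> \<le> real n / real m * a m + C"
        using m nonneg of_nat_div_le_of_nat[of n m, where 'a = real]
        by (intro add_mono mult_right_mono C) auto
      finally have "a n / real n \<le> (real n / real m * a m + C) / real n"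
        by (simp add: divide_right_mono)
      then show ?thesis using that by (simp add: add_divide_distrib)
    qed
    have "(\<lambda>n. a m / real m + C / real n) \<longlonglongrightarrow> a m / real m"
      using tendsto_add[OF tendsto_const[of "a m / real m"] lim_const_over_n[of C]] by simp
    then have "\<forall>\<^sub>F n in sequentially. a m / real m + C / real n < u"
      using m by (simp add: order_tendsto_iff)
    then show ?thesis
      using eventually_ge_at_top[of 1] by eventually_elim (use bound in force)
  qed
  have "(\<lambda>n. a n / real n) \<longlonglongrightarrow> L"
  proof (rule order_tendstoI)
    fix u assume u: "u < L"
    show "\<forall>\<^sub>F n in sequentially. u < a n / real n"
      using eventually_ge_at_top[of 1] by eventually_elim (use u lower in force)
  qed (rule upper)
  then show ?thesis by (simp add: L_def)
qed

section \<open>Names of orbits and entropy\<close>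

locale invariant_system =
  fixes f :: "'a::metric_space \<Rightarrow> 'a" and \<mu> :: "'a measure"
  assumes invariant: "invariant_measure f \<mu>"
begin

lemma sets_mu [simp, measurable_cong]: "sets \<mu> = sets borel"
  and distr_f: "distr \<mu> borel f = \<mu>"
  and measurable_f [measurable]: "f \<in> borel_measurable borel"
  using invariant by (auto simp: invariant_measure_def borel_probs_def)

lemma space_mu [simp]: "space \<mu> = UNIV"
  using sets_eq_imp_space_eq[OF sets_mu] by simp

sublocale prob_space \<mu>
  using invariant by (auto simp: invariant_measure_def borel_probs_def)

lemma mu_in_borel_probs: "\<mu> \<in> borel_probs"
  using invariant by (simp add: invariant_measure_def)

lemma prob_UNIV [simp]: "prob UNIV = 1"
  using prob_space by simp

lemma measurable_funpow [measurable]: "f ^^ n \<in> borel_measurable borel"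
  by (induction n) (auto intro: measurable_comp)

lemma integral_comp_f:
  fixes g :: "'a \<Rightarrow> real"
  assumes [measurable]: "g \<in> borel_measurable borel"
  shows "(\<integral>x. g (f x) \<partial>\<mu>) = (\<integral>x. g x \<partial>\<mu>)"
proof -
  have "(\<integral>x. g x \<partial>\<mu>) = (\<integral>x. g x \<partial>distr \<mu> borel f)"
    by (simp add: distr_f)
  also have "\<dots> = (\<integral>x. g (f x) \<partial>\<mu>)"
    by (rule integral_distr) auto
  finally show ?thesis ..
qed

lemma integral_comp_funpow:
  fixes g :: "'a \<Rightarrow> real"
  assumes [measurable]: "g \<in> borel_measurable borel"
  shows "(\<integral>x. g ((f ^^ n) x) \<partial>\<mu>) = (\<integral>x. g x \<partial>\<mu>)"
proof (induction n)
  case (Suc n)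
  have "(\<integral>x. g ((f ^^ Suc n) x) \<partial>\<mu>) = (\<integral>x. g ((f ^^ n) (f x)) \<partial>\<mu>)"
    by (simp only: funpow_Suc_right o_apply)
  also have "\<dots> = (\<integral>x. g ((f ^^ n) x) \<partial>\<mu>)"
    by (rule integral_comp_f) measurable
  finally show ?case using Suc by simp
qed simp

lemma prob_vimage_funpow:
  assumes [measurable]: "A \<in> sets borel"
  shows "prob ((f ^^ n) -` A) = prob A"
proof -
  have "(f ^^ n) -` A \<in> sets borel"
    using measurable_sets[OF measurable_funpow assms] by simp
  then show ?thesis
    using integral_comp_funpow[of "indicator A" n]
    by (simp flip: indicator_vimage)
qed

end

text \<open>A finite Borel partition presented as a labelling by letters: orbit segments become
  lists and entropies become sums over lists.\<close>

locale coded_system = invariant_system f \<mu>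
  for f :: "'a::metric_space \<Rightarrow> 'a" and \<mu> :: "'a measure" +
  fixes c :: "'a \<Rightarrow> 'b"
  assumes finite_range_c: "finite (range c)"
    and sets_vimage_c: "\<And>a. c -` {a} \<in> sets borel"
begin

definition name :: "nat \<Rightarrow> 'a \<Rightarrow> 'b list" where
  "name n x = map (\<lambda>i. c ((f ^^ i) x)) [0..<n]"

lemma name_0 [simp]: "name 0 x = []"
  and length_name [simp]: "length (name n x) = n"
  and nth_name [simp]: "i < n \<Longrightarrow> name n x ! i = c ((f ^^ i) x)"
  by (simp_all add: name_def)

lemma name_eq_iff: "name n y = name n x \<longleftrightarrow> (\<forall>i<n. c ((f ^^ i) y) = c ((f ^^ i) x))"
  by (simp add: list_eq_iff_nth_eq)

lemma name_Suc: "name (Suc n) x = c x # name n (f x)"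
  by (rule nth_equalityI)
    (auto simp: nth_Cons funpow_swap1 simp del: funpow.simps split: nat.split, simp add: funpow_swap1)

lemma take_name: "take n (name (n + m) x) = name n x"
  by (rule nth_equalityI) auto

lemma drop_name: "drop n (name (n + m) x) = name m ((f ^^ n) x)"
  by (rule nth_equalityI) (auto simp: funpow_add add.commute)

definition cylinder :: "'b list \<Rightarrow> 'a set" where
  "cylinder w = {x. name (length w) x = w}"

lemma cylinder_Nil [simp]: "cylinder [] = UNIV"
  by (simp add: cylinder_def)

lemma cylinder_Cons: "cylinder (a # w) = c -` {a} \<inter> f -` cylinder w"
  by (auto simp: cylinder_def name_Suc)

lemma sets_cylinder [simp, measurable]: "cylinder w \<in> sets borel"
proof (induction w)
  case (Cons a w)
  then have "f -` cylinder w \<in> sets borel"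
    using measurable_sets[OF measurable_f Cons] by simp
  with sets_vimage_c show ?case by (simp add: cylinder_Cons)
qed simp

text \<open>Words realised by no orbit are kept. They have probability 0 and do not affect
  entropies, and the full product structure allows recursion over letters.\<close>

definition words :: "nat \<Rightarrow> 'b list set" where
  "words n = {w. set w \<subseteq> range c \<and> length w = n}"

lemma finite_words [simp]: "finite (words n)"
  unfolding words_def by (rule finite_lists_length_eq[OF finite_range_c])

lemma words_0: "words 0 = {[]}"
  by (auto simp: words_def)

lemma name_in_words [simp]: "name n x \<in> words n"
  by (auto simp: words_def name_def)

lemma length_words: "w \<in> words n \<Longrightarrow> length w = n"
  by (simp add: words_def)

lemma sum_words_Suc:
  fixes g :: "'b list \<Rightarrow> real"
  shows "(\<Sum>w\<in>words (Suc n). g w) = (\<Sum>w\<in>words n. \<Sum>a\<in>range c. g (a # w))"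
proof -
  have "words (Suc n) = (\<lambda>(w, a). a # w) ` (words n \<times> range c)"
    by (force simp: words_def length_Suc_conv image_iff)
  moreover have "inj_on (\<lambda>(w, a). a # w) (words n \<times> range c)"
    by (auto simp: inj_on_def)
  ultimately show ?thesis
    by (simp add: sum.reindex case_prod_unfold sum.cartesian_product)
qed

definition word_prob :: "'b list \<Rightarrow> real" where
  "word_prob w = prob (cylinder w)"

lemma word_prob_nonneg [simp]: "0 \<le> word_prob w"
  by (simp add: word_prob_def)

text \<open>Functions of the name are simple functions, so measurability, integrability and
  expectations reduce to finite sums over words.\<close>

lemma name_decomposition:
  fixes g :: "'b list \<Rightarrow> real"
  shows "g (name n x) = (\<Sum>w\<in>words n. g w * indicator (cylinder w) x)"
proof -
  have "(\<Sum>w\<in>words n. g w * indicator (cylinder w) x) = (\<Sum>w\<in>words n. if w = name n x then g w else 0)"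
    by (intro sum.cong) (auto simp: cylinder_def length_words indicator_def)
  then show ?thesis by simp
qed

lemma measurable_comp_name [measurable]:
  fixes g :: "'b list \<Rightarrow> real"
  shows "(\<lambda>x. g (name n x)) \<in> borel_measurable borel"
  unfolding name_decomposition by measurable

lemma expectation_name:
  fixes g :: "'b list \<Rightarrow> real"
  shows "(\<integral>x. g (name n x) \<partial>\<mu>) = (\<Sum>w\<in>words n. word_prob w * g w)"
  unfolding name_decomposition
  by (subst Bochner_Integration.integral_sum)
    (auto simp: word_prob_def mult.commute intro!: integrable_real_indicator simp: emeasure_eq_measure)

lemma sum_word_prob: "(\<Sum>w\<in>words n. word_prob w) = 1"
  using expectation_name[of "\<lambda>_. 1" n] prob_space by simp

text \<open>There are finitely many words, so the union of the null cylinders is null. Logarithms of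
  word probabilities can then be split almost everywhere.\<close>

lemma word_prob_name_pos_AE: "AE x in \<mu>. 0 < word_prob (name n x)"
proof -
  have "AE x in \<mu>. \<forall>w\<in>words n. word_prob w = 0 \<longrightarrow> x \<notin> cylinder w"
    by (intro AE_finite_allI finite_words AE_impI AE_not_in)
      (auto simp: word_prob_def null_sets_def emeasure_eq_measure)
  then show ?thesis
    by eventually_elim (use name_in_words in \<open>force simp: cylinder_def less_le\<close>)
qed

definition name_entropy :: "nat \<Rightarrow> real" where
  "name_entropy n = - (\<Sum>w\<in>words n. word_prob w * ln (word_prob w))"

lemma name_entropy_0: "name_entropy 0 = 0"
  using prob_space by (simp add: name_entropy_def words_0 word_prob_def)

lemma name_entropy_nonneg: "0 \<le> name_entropy n"
proof -
  have "word_prob w * ln (word_prob w) \<le> 0" for w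
    by (cases "word_prob w = 0")
      (auto simp: word_prob_def mult_le_0_iff zero_less_measure_iff)
  then show ?thesis by (simp add: name_entropy_def sum_nonpos)
qed

lemma name_entropy_expectation: "name_entropy n = (\<integral>x. - ln (word_prob (name n x)) \<partial>\<mu>)"
  using expectation_name[of "\<lambda>w. - ln (word_prob w)" n] by (simp add: name_entropy_def sum_negf)

text \<open>Two choices of \<open>W\<close> matter later: product weights give subadditivity, and
  Hamming weights give the lower bound on separated sets.\<close>

lemma name_entropy_gibbs:
  assumes "\<And>w. w \<in> words n \<Longrightarrow> 0 \<le> W w"
    "\<And>w. w \<in> words n \<Longrightarrow> 0 < word_prob w \<Longrightarrow> 0 < W w"
  shows "name_entropy n \<le> (\<integral>x. - ln (W (name n x)) \<partial>\<mu>) + ln (sum W (words n))"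
  using gibbs_inequality[of "words n" word_prob W] assms
  by (simp add: name_entropy_def expectation_name[of "\<lambda>w. ln (W w)"] sum_word_prob)

lemma integrable_comp_name [simp]:
  fixes g :: "'b list \<Rightarrow> real"
  shows "integrable \<mu> (\<lambda>x. g (name n x))"
  unfolding name_decomposition
  by (intro Bochner_Integration.integrable_sum integrable_mult_right integrable_real_indicator)
    (auto simp: emeasure_eq_measure)

text \<open>The Gibbs inequality against the product of the laws of the first \<open>n\<close> and
  the last \<open>m\<close> letters, which has total mass 1. By invariance the second factor
  contributes \<open>name_entropy m\<close>.\<close>

lemma name_entropy_subadditive: "name_entropy (n + m) \<le> name_entropy n + name_entropy m"
proof -
  let ?W = "\<lambda>w. word_prob (take n w) * word_prob (drop n w)"
  \<comment> \<open>A cylinder lies inside the cylinder of its prefix and inside the pullback of the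
    cylinder of its suffix, so both factors inherit positivity.\<close>
  have pos: "0 < ?W w" if "w \<in> words (n + m)" "0 < word_prob w" for w
  proof -
    have l: "length w = n + m" using that by (simp add: words_def)
    have "cylinder w \<subseteq> cylinder (take n w)" "cylinder w \<subseteq> (f ^^ n) -` cylinder (drop n w)"
      using l by (auto simp: cylinder_def take_name) (metis drop_name)
    moreover have "(f ^^ n) -` cylinder (drop n w) \<in> sets borel"
      using measurable_sets[OF measurable_funpow sets_cylinder] by simp
    ultimately have "word_prob w \<le> word_prob (take n w)" "word_prob w \<le> word_prob (drop n w)"
      unfolding word_prob_def
      using prob_vimage_funpow[OF sets_cylinder] finite_measure_mono by (simp, metis sets_mu)
    with that show ?thesis by simp
  qed
  have "words (n + m) = (\<lambda>(u, v). u @ v) ` (words n \<times> words m)"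
  proof -
    have "w \<in> (\<lambda>(u, v). u @ v) ` (words n \<times> words m)" if "w \<in> words (n + m)" for w
      using that by (intro image_eqI[of _ _ "(take n w, drop n w)"])
        (auto simp: words_def dest: in_set_takeD in_set_dropD)
    then show ?thesis by (auto simp: words_def)
  qed
  moreover have "inj_on (\<lambda>(u, v). u @ v) (words n \<times> words m)"
    by (auto simp: inj_on_def words_def)
  ultimately have "sum ?W (words (n + m)) = (\<Sum>u\<in>words n. \<Sum>v\<in>words m. word_prob u * word_prob v)"
    by (simp add: sum.reindex case_prod_unfold sum.cartesian_product) (rule sum.cong; simp add: mem_Times_iff words_def)
  also have "\<dots> = 1"
    by (simp add: sum_word_prob flip: sum_product)
  finally have "name_entropy (n + m) \<le> (\<integral>x. - ln (?W (name (n + m) x)) \<partial>\<mu>)"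
    using name_entropy_gibbs[of "n + m" ?W] pos by simp
  also have "\<dots> = (\<integral>x. - ln (word_prob (name n x)) + - ln (word_prob (name m ((f ^^ n) x))) \<partial>\<mu>)"
  proof (rule integral_cong_AE)
    \<comment> \<open>The logarithm of the product splits only where both factors are positive,
      since \<open>ln 0 = 0\<close>; hence an identity almost everywhere.\<close>
    show "AE x in \<mu>. - ln (?W (name (n + m) x))
        = - ln (word_prob (name n x)) + - ln (word_prob (name m ((f ^^ n) x)))"
      using word_prob_name_pos_AE[of "n + m"]
    proof eventually_elim
      case (elim x)
      then have "0 < ?W (name (n + m) x)" by (rule pos[rotated]) simp
      then have "0 < word_prob (name n x)" "0 < word_prob (name m ((f ^^ n) x))"
        by (auto simp: take_name drop_name zero_less_mult_iff less_le)
      then show ?case by (simp add: take_name drop_name ln_mult)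
    qed
    have [measurable]: "(\<lambda>x. ln (word_prob (name m x))) \<in> borel_measurable borel"
      "(\<lambda>x. ln (word_prob (name n x))) \<in> borel_measurable borel"
      by (rule measurable_comp_name)+
    show "(\<lambda>x. - ln (word_prob (name n x)) + - ln (word_prob (name m ((f ^^ n) x)))) \<in> borel_measurable \<mu>"
      by measurable
    show "(\<lambda>x. - ln (?W (name (n + m) x))) \<in> borel_measurable \<mu>"
      using measurable_comp_name[of "\<lambda>w. - ln (?W w)"] by simp
  qed
  also have "\<dots> = name_entropy n + name_entropy m"
  proof -
    have "integrable \<mu> (\<lambda>x. - ln (word_prob (name m ((f ^^ n) x))))"
      using integrable_comp_name[of "\<lambda>w. - ln (word_prob (drop n w))" "n + m"]
      by (simp add: drop_name)
    moreover have "integrable \<mu> (\<lambda>x. - ln (word_prob (name n x)))"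
      by (rule integrable_comp_name)
    ultimately show ?thesis
      unfolding name_entropy_expectation
      using integral_comp_funpow[OF measurable_comp_name[of "\<lambda>w. - ln (word_prob w)" m], of n]
      by (simp only: Bochner_Integration.integral_add)
  qed
  finally show ?thesis .
qed

definition entropy_rate :: real where
  "entropy_rate = lim (\<lambda>n. name_entropy n / real n)"

text \<open>Fekete's lemma makes the \<open>lim\<close> in \<open>entropy_rate\<close> a genuine
  limit.\<close>

lemma entropy_rate_LIMSEQ: "(\<lambda>n. name_entropy n / real n) \<longlonglongrightarrow> entropy_rate"
  unfolding entropy_rate_def
  using subadditive_converges[OF name_entropy_subadditive name_entropy_nonneg]
  by (metis limI)

end

section \<open>Partitions as codes\<close>

definition cell :: "'a set set \<Rightarrow> 'a \<Rightarrow> 'a set" where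
  "cell \<xi> x = (THE A. A \<in> \<xi> \<and> x \<in> A)"

lemma cell_eq:
  assumes "partition_on UNIV \<xi>" "A \<in> \<xi>" "x \<in> A"
  shows "cell \<xi> x = A"
  unfolding cell_def using assms by (intro the_equality) (auto simp: partition_on_def disjoint_def)

lemma cell_in: "partition_on UNIV \<xi> \<Longrightarrow> cell \<xi> x \<in> \<xi>"
  and self_in_cell: "partition_on UNIV \<xi> \<Longrightarrow> x \<in> cell \<xi> x"
  using cell_eq partition_onD1[of UNIV \<xi>] by (metis UNIV_I UnionE)+

lemma in_cell_iff: "partition_on UNIV \<xi> \<Longrightarrow> y \<in> cell \<xi> z \<longleftrightarrow> cell \<xi> y = cell \<xi> z"
  by (metis cell_eq cell_in self_in_cell)

lemma cell_vimage: "partition_on UNIV \<xi> \<Longrightarrow> A \<in> \<xi> \<Longrightarrow> cell \<xi> -` {A} = A"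
  by (intro set_eqI) (metis cell_eq self_in_cell vimage_singleton_eq)

lemma range_cell: "partition_on UNIV \<xi> \<Longrightarrow> range (cell \<xi>) = \<xi>"
proof (intro equalityI subsetI)
  fix A assume \<xi>: "partition_on UNIV \<xi>" and A: "A \<in> \<xi>"
  then obtain x where "x \<in> A"
    using partition_onD3 by fastforce
  with \<xi> A have "cell \<xi> x = A"
    by (rule cell_eq)
  then show "A \<in> range (cell \<xi>)" by blast
qed (auto simp: cell_in)

text \<open>An element of the join is a nonempty intersection of cells, one from each pullback, and
  any of its points determines all these cells.\<close>

lemma iterated_join_eq:
  assumes \<xi>: "partition_on UNIV \<xi>"
  shows "iterated_join f \<xi> n = range (\<lambda>x. {y. \<forall>i<n. cell \<xi> ((f ^^ i) y) = cell \<xi> ((f ^^ i) x)})"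
    (is "_ = range ?K")
proof -
  define P where "P i = (\<lambda>A. (f ^^ i) -` A) ` \<xi> - {{}}" for i
  have Inter: "\<Inter> (g ` P ` {..<n}) = ?K x"
    if g: "\<And>i. i < n \<Longrightarrow> g (P i) \<in> P i \<and> x \<in> g (P i)" for g x
  proof -
    have "g (P i) = (f ^^ i) -` cell \<xi> ((f ^^ i) x)" if "i < n" for i
      using g[OF that] cell_eq[OF \<xi>] unfolding P_def by fastforce
    then have "\<Inter> (g ` P ` {..<n}) = (\<Inter>i<n. (f ^^ i) -` cell \<xi> ((f ^^ i) x))"
      by auto
    also have "\<dots> = ?K x"
      by (auto simp: in_cell_iff[OF \<xi>])
    finally show ?thesis .
  qed
  have join: "iterated_join f \<xi> n = (\<Union>g\<in>Pi (P ` {..<n}) (\<lambda>Q. Q). {\<Inter> (g ` P ` {..<n})}) - {{}}"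
    unfolding iterated_join_def P_def common_refinement ..
  show ?thesis
  proof (intro equalityI subsetI)
    fix B assume "B \<in> iterated_join f \<xi> n"
    then obtain g x where g: "g \<in> Pi (P ` {..<n}) (\<lambda>Q. Q)" "B = \<Inter> (g ` P ` {..<n})" "x \<in> B"
      unfolding join by blast
    then have "B = ?K x"
      using Inter[of g x] by (auto simp: Pi_iff)
    then show "B \<in> range ?K" by blast
  next
    fix B assume "B \<in> range ?K"
    then obtain x where x: "B = ?K x" by blast
    \<comment> \<open>The choice depends on the partition and not on the time, so it stays
      consistent when pullbacks at different times coincide.\<close>
    define g where "g Q = (SOME C. C \<in> Q \<and> x \<in> C)" for Q
    have g: "g (P i) \<in> P i \<and> x \<in> g (P i)" for i
      unfolding g_def
    proof (rule someI)
      show "(f ^^ i) -` cell \<xi> ((f ^^ i) x) \<in> P i \<and> x \<in> (f ^^ i) -` cell \<xi> ((f ^^ i) x)"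
        using cell_in[OF \<xi>] self_in_cell[OF \<xi>] unfolding P_def by force
    qed
    then have "B = \<Inter> (g ` P ` {..<n})"
      using Inter[of g x] x by simp
    moreover have "g \<in> Pi (P ` {..<n}) (\<lambda>Q. Q)"
      using g by auto
    moreover have "B \<noteq> {}"
      using x by auto
    ultimately show "B \<in> iterated_join f \<xi> n"
      unfolding join by blast
  qed
qed

lemma (in invariant_system) coded_system_cell:
  assumes "finite_borel_partition \<xi>"
  shows "coded_system f \<mu> (cell \<xi>)"
proof
  show "finite (range (cell \<xi>))"
    using assms by (simp add: finite_borel_partition_def range_cell)
  show "cell \<xi> -` {A} \<in> sets borel" for A
  proof (cases "A \<in> \<xi>")
    case True
    then show ?thesis using assms by (auto simp: finite_borel_partition_def cell_vimage)
  next
    case False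
    then have "cell \<xi> -` {A} = {}"
      using assms cell_in[of \<xi>] by (auto simp: finite_borel_partition_def)
    then show ?thesis by simp
  qed
qed

lemma (in coded_system) cylinder_name:
  "cylinder (name n x) = {y. \<forall>i<n. c ((f ^^ i) y) = c ((f ^^ i) x)}"
  by (simp add: cylinder_def name_eq_iff)

text \<open>Realised names correspond bijectively to their cylinders, which are nonempty and
  disjoint. The other words have empty cylinders and contribute 0.\<close>

lemma (in coded_system) name_entropy_eq_sum_cylinders:
  "name_entropy n = - (\<Sum>B\<in>range (\<lambda>x. cylinder (name n x)). prob B * ln (prob B))"
proof -
  have "inj_on cylinder (range (name n))"
  proof (rule inj_onI, clarify)
    fix x y assume "cylinder (name n x) = cylinder (name n y)"
    moreover have "x \<in> cylinder (name n x)" by (simp add: cylinder_def)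
    ultimately have "x \<in> cylinder (name n y)" by simp
    then show "name n x = name n y" by (simp add: cylinder_def)
  qed
  then have "(\<Sum>B\<in>cylinder ` range (name n). prob B * ln (prob B))
      = (\<Sum>w\<in>range (name n). word_prob w * ln (word_prob w))"
    by (simp add: sum.reindex word_prob_def)
  also have "\<dots> = (\<Sum>w\<in>words n. word_prob w * ln (word_prob w))"
  proof (rule sum.mono_neutral_left)
    show "\<forall>w\<in>words n - range (name n). word_prob w * ln (word_prob w) = 0"
    proof
      fix w assume w: "w \<in> words n - range (name n)"
      then have "length w = n" "w \<notin> range (name n)" by (auto simp: words_def)
      then have "cylinder w = {}" unfolding cylinder_def by (metis (mono_tags, lifting) Collect_empty_eq rangeI)
      then show "word_prob w * ln (word_prob w) = 0" by (simp add: word_prob_def)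
    qed
  qed auto
  finally show ?thesis by (simp add: name_entropy_def image_image)
qed

lemma partition_entropy_iterated_join:
  assumes "coded_system f \<mu> (cell \<xi>)" "partition_on UNIV \<xi>"
  shows "partition_entropy \<mu> (iterated_join f \<xi> n) = coded_system.name_entropy f \<mu> (cell \<xi>) n"
  unfolding coded_system.name_entropy_eq_sum_cylinders[OF assms(1)]
    coded_system.cylinder_name[OF assms(1)] partition_entropy_def iterated_join_eq[OF assms(2)] ..

lemma entropy_wrt_partition_eq:
  assumes "coded_system f \<mu> (cell \<xi>)" "partition_on UNIV \<xi>"
  shows "entropy_wrt_partition \<mu> f \<xi> = coded_system.entropy_rate f \<mu> (cell \<xi>)"
  by (simp add: entropy_wrt_partition_def partition_entropy_iterated_join[OF assms]
      coded_system.entropy_rate_def[OF assms(1)])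

section \<open>The pointwise ergodic theorem\<close>

lemma birkhoff_sum_Suc: "birkhoff_sum f g (Suc n) x = g x + birkhoff_sum f g n (f x)"
  unfolding birkhoff_sum_def
  by (subst sum.lessThan_Suc_shift) (simp add: funpow_swap1)

locale ergodic_system =
  fixes f :: "'a::metric_space \<Rightarrow> 'a" and \<mu> :: "'a measure"
  assumes ergodic: "ergodic_measure f \<mu>"
begin

sublocale invariant_system f \<mu>
  using ergodic by unfold_locales (simp add: ergodic_measure_def)

text \<open>\<open>max_sum g n\<close> is the maximum of the Birkhoff sums of \<open>g\<close> of length at most \<open>n\<close>. The
  difference \<open>max_sum g (Suc n) x - max_sum g n (f x)\<close> is
  \<open>max (- max_sum g n (f x)) (g x)\<close>, which tends to \<open>g x\<close> wherever the maxima are unbounded.\<close>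

primrec max_sum :: "('a \<Rightarrow> real) \<Rightarrow> nat \<Rightarrow> 'a \<Rightarrow> real" where
  "max_sum g 0 x = 0"
| "max_sum g (Suc n) x = max 0 (g x + max_sum g n (f x))"

lemma max_sum_nonneg: "0 \<le> max_sum g n x"
  by (cases n) auto

lemma max_sum_le_Suc: "max_sum g n x \<le> max_sum g (Suc n) x"
proof (induction n arbitrary: x)
  case (Suc n)
  then have "g x + max_sum g n (f x) \<le> g x + max_sum g (Suc n) (f x)" by (simp del: max_sum.simps)
  then show ?case unfolding max_sum.simps(2)[of g _ x] by (rule max.mono[OF order_refl])
qed simp

lemma max_sum_mono: "m \<le> n \<Longrightarrow> max_sum g m x \<le> max_sum g n x"
  by (rule lift_Suc_mono_le[of "\<lambda>n. max_sum g n x"]) (rule max_sum_le_Suc)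

lemma birkhoff_sum_le_max_sum: "birkhoff_sum f g n x \<le> max_sum g n x"
proof (induction n arbitrary: x)
  case (Suc n)
  then show ?case by (simp add: birkhoff_sum_Suc le_max_iff_disj)
qed (simp add: birkhoff_sum_def)

lemma max_sum_le: "(\<And>x. \<bar>g x\<bar> \<le> B) \<Longrightarrow> max_sum g n x \<le> real n * B"
proof (induction n arbitrary: x)
  case (Suc n)
  have "g x \<le> B" "0 \<le> B" using Suc.prems[of x] by auto
  moreover have "max_sum g n (f x) \<le> real n * B" by (rule Suc.IH[OF Suc.prems])
  ultimately show ?case by (simp add: algebra_simps)
qed simp

lemma measurable_max_sum [measurable]:
  assumes [measurable]: "g \<in> borel_measurable borel"
  shows "max_sum g n \<in> borel_measurable borel"
proof (induction n)
  case 0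
  have "max_sum g 0 = (\<lambda>x. 0)" by auto
  then show ?case by simp
next
  case (Suc n)
  note [measurable] = Suc
  have "max_sum g (Suc n) = (\<lambda>x. max 0 (g x + max_sum g n (f x)))" by auto
  then show ?case by simp
qed

text \<open>A maximal ergodic argument: the set \<open>A\<close> where \<open>max_sum\<close> is
  unbounded is invariant. If it had full measure, the nonnegative integrals of \<open>D n\<close>
  would converge to the integral of \<open>g\<close>, which is negative.\<close>

lemma birkhoff_sum_bdd_above_AE:
  assumes g [measurable]: "g \<in> borel_measurable borel"
    and B: "\<And>x. \<bar>g x\<bar> \<le> B" and neg: "(\<integral>x. g x \<partial>\<mu>) < 0"
  shows "AE x in \<mu>. \<exists>C. \<forall>n. birkhoff_sum f g n x \<le> C"
proof -
  define A where "A = {x. \<forall>k::nat. \<exists>n. real k < max_sum g n x}"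
  have [measurable]: "A \<in> sets borel"
    unfolding A_def by measurable
  have A_iff: "x \<in> A \<longleftrightarrow> (\<forall>C. \<exists>n. C < max_sum g n x)" for x
    unfolding A_def by (auto, meson le_less_trans reals_Archimedean2 less_imp_le)
  \<comment> \<open>Ergodicity is formulated for exactly invariant sets, so the equivalence is
    proved at every point.\<close>
  have "f x \<in> A \<longleftrightarrow> x \<in> A" for x
  proof
    assume fx: "f x \<in> A"
    show "x \<in> A" unfolding A_iff
    proof
      fix C
      obtain n where "C - g x < max_sum g n (f x)" using fx unfolding A_iff by blast
      then have "C < max_sum g (Suc n) x" by (simp add: less_max_iff_disj algebra_simps)
      then show "\<exists>n. C < max_sum g n x" by blast
    qed
  next
    assume x: "x \<in> A"
    show "f x \<in> A" unfolding A_iff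
    proof
      fix C
      \<comment> \<open>The nonnegative threshold excludes the value 0 in the recursion for
        \<open>max_sum\<close>, and \<open>\<bar>g x\<bar>\<close> absorbs the shift along the
        orbit.\<close>
      obtain n where "max 0 (C + \<bar>g x\<bar>) < max_sum g n x" using x unfolding A_iff by blast
      then have "max 0 (C + \<bar>g x\<bar>) < max_sum g (Suc n) x"
        using max_sum_le_Suc[of g n x] by linarith
      then have "C < max_sum g n (f x)" by (auto simp: max_def split: if_splits)
      then show "\<exists>n. C < max_sum g n (f x)" by blast
    qed
  qed
  then have "f -` A = A" by auto
  then have "prob A = 0 \<or> prob A = 1"
    using ergodic by (auto simp: ergodic_measure_def)
  moreover have "prob A \<noteq> 1"
  proof
    assume "prob A = 1"
    then have AE_A: "AE x in \<mu>. x \<in> A"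
      by (subst prob_eq_1[symmetric]) (auto simp: Int_absorb1)
    define D where "D n x = max (- max_sum g n (f x)) (g x)" for n x
    have [measurable]: "D n \<in> borel_measurable borel" for n
      unfolding D_def by measurable
    have D_eq: "D n x = max_sum g (Suc n) x - max_sum g n (f x)" for n x
      by (auto simp: D_def max_def)
    have int_max: "integrable \<mu> (max_sum g n)" for n
      by (rule integrable_const_bound[where B = "real n * B"])
        (use max_sum_le[OF B] max_sum_nonneg in \<open>auto intro!: AE_I2 simp: abs_of_nonneg\<close>)
    \<comment> \<open>Invariance removes \<open>f\<close> from the subtracted term, and
      \<open>max_sum\<close> increases with the length.\<close>
    have "0 \<le> (\<integral>x. D n x \<partial>\<mu>)" for n
    proof -
      have "integrable \<mu> (\<lambda>x. max_sum g n (f x))"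
        by (rule integrable_const_bound[where B = "real n * B"])
          (use max_sum_le[OF B] max_sum_nonneg in \<open>auto intro!: AE_I2 simp: abs_of_nonneg\<close>)
      then have "(\<integral>x. D n x \<partial>\<mu>) = (\<integral>x. max_sum g (Suc n) x \<partial>\<mu>) - (\<integral>x. max_sum g n x \<partial>\<mu>)"
        unfolding D_eq using int_max[of "Suc n"]
        by (subst Bochner_Integration.integral_diff) (auto simp: integral_comp_f[of "max_sum g n"] simp del: max_sum.simps)
      also have "0 \<le> \<dots>"
        using integral_mono[OF int_max int_max, of n "Suc n"] max_sum_le_Suc by (simp del: max_sum.simps)
      finally show ?thesis .
    qed
    moreover have "(\<lambda>n. \<integral>x. D n x \<partial>\<mu>) \<longlonglongrightarrow> (\<integral>x. g x \<partial>\<mu>)"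
    proof (rule integral_dominated_convergence[where w = "\<lambda>_. B"])
      show "AE x in \<mu>. (\<lambda>n. D n x) \<longlonglongrightarrow> g x"
        using AE_A
      proof eventually_elim
        case (elim x)
        then have "f x \<in> A" using \<open>f -` A = A\<close> by auto
        then obtain N where N: "- g x < max_sum g N (f x)" unfolding A_iff by blast
        \<comment> \<open>Past \<open>N\<close> the other entry of the maximum stays below
          \<open>g x\<close>, so the sequence is eventually constant.\<close>
        have "D n x = g x" if "N \<le> n" for n
          using N max_sum_mono[OF that, of g "f x"] by (auto simp: D_def)
        then have "\<forall>\<^sub>F n in sequentially. D n x = g x"
          by (auto simp: eventually_sequentially)
        then show ?case by (rule tendsto_eventually)
      qed
      show "AE x in \<mu>. norm (D n x) \<le> B" for n
      proof (rule AE_I2)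
        fix x
        show "norm (D n x) \<le> B"
          using B[of x] max_sum_nonneg[of g n "f x"] by (auto simp: D_def abs_if max_def split: if_splits)
      qed
    qed auto
    ultimately have "0 \<le> (\<integral>x. g x \<partial>\<mu>)"
      by (intro LIMSEQ_le_const) auto
    with neg show False by simp
  qed
  ultimately have "prob A = 0" by blast
  then have "AE x in \<mu>. x \<notin> A"
    by (intro AE_not_in) (auto simp: null_sets_def emeasure_eq_measure)
  then show ?thesis
  proof eventually_elim
    case (elim x)
    then obtain C where "\<And>n. max_sum g n x \<le> C" unfolding A_iff by (auto simp: not_less)
    then show ?case using birkhoff_sum_le_max_sum by (metis order_trans)
  qed
qed

text \<open>Subtracting the mean plus \<open>e / 2\<close> makes the integral negative. The shifted
  Birkhoff sums are then bounded above, and the bound disappears after division by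
  \<open>n\<close>.\<close>

lemma birkhoff_average_AE_less:
  assumes g [measurable]: "g \<in> borel_measurable borel"
    and B: "\<And>x. \<bar>g x\<bar> \<le> B" and e: "0 < e"
  shows "AE x in \<mu>. \<forall>\<^sub>F n in sequentially. birkhoff_sum f g n x / real n < (\<integral>x. g x \<partial>\<mu>) + e"
proof -
  define I where "I = (\<integral>x. g x \<partial>\<mu>)"
  define h where "h x = g x - (I + e / 2)" for x
  have "integrable \<mu> g"
    by (rule integrable_const_bound[where B = B]) (use B in \<open>auto intro!: AE_I2\<close>)
  then have "(\<integral>x. h x \<partial>\<mu>) = - (e / 2)"
    unfolding h_def by (simp add: I_def prob_space)
  moreover have "\<bar>h x\<bar> \<le> B + \<bar>I + e / 2\<bar>" for x
    using B[of x] unfolding h_def by linarith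
  moreover have "h \<in> borel_measurable borel" unfolding h_def by measurable
  ultimately have "AE x in \<mu>. \<exists>C. \<forall>n. birkhoff_sum f h n x \<le> C"
    using e by (intro birkhoff_sum_bdd_above_AE[where B = "B + \<bar>I + e / 2\<bar>"]) auto
  then show ?thesis
  proof eventually_elim
    case (elim x)
    then obtain C where C: "\<And>n. birkhoff_sum f h n x \<le> C" by blast
    have "\<forall>\<^sub>F n in sequentially. C / real n < e / 2"
      by (rule order_tendstoD(2)[OF lim_const_over_n]) (use e in simp)
    then show ?case
      using eventually_gt_at_top[of 0]
    proof eventually_elim
      case (elim n)
      have "birkhoff_sum f h n x = birkhoff_sum f g n x - real n * (I + e / 2)"
        by (simp add: birkhoff_sum_def h_def sum_subtractf)
      with C[of n] have "birkhoff_sum f g n x \<le> C + real n * (I + e / 2)" by linarith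
      then have "birkhoff_sum f g n x / real n \<le> (C + real n * (I + e / 2)) / real n"
        by (rule divide_right_mono) simp
      also have "\<dots> = C / real n + (I + e / 2)" using elim by (simp add: field_simps)
      finally show ?case using elim unfolding I_def by linarith
    qed
  qed
qed

text \<open>Birkhoff's theorem with a fixed tolerance, from the one-sided bound for \<open>g\<close>
  and \<open>- g\<close>. The exceptional null set may depend on \<open>e\<close>.\<close>

theorem birkhoff_average_AE_close:
  assumes g [measurable]: "g \<in> borel_measurable borel"
    and B: "\<And>x. \<bar>g x\<bar> \<le> B" and e: "0 < e"
  shows "AE x in \<mu>. \<forall>\<^sub>F n in sequentially. \<bar>birkhoff_sum f g n x / real n - (\<integral>x. g x \<partial>\<mu>)\<bar> < e"
proof -
  have "birkhoff_sum f (\<lambda>x. - g x) n x = - birkhoff_sum f g n x" for n x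
    by (simp add: birkhoff_sum_def sum_negf)
  then have "AE x in \<mu>. \<forall>\<^sub>F n in sequentially. - birkhoff_sum f g n x / real n < - (\<integral>x. g x \<partial>\<mu>) + e"
    using birkhoff_average_AE_less[of "\<lambda>x. - g x" B e] B e by simp
  with birkhoff_average_AE_less[OF assms] show ?thesis
  proof eventually_elim
    case (elim x)
    then show ?case by eventually_elim (auto simp: abs_less_iff)
  qed
qed

end

section \<open>Weak-star neighbourhoods\<close>

text \<open>Containing a ball given by finitely many test functions and one tolerance is inherited
  through the generation of the topology: intersections merge the test functions, and a union
  inherits the ball of one member.\<close>

lemma weak_star_nbhd_basic:
  assumes "F \<in> nbhds_of \<mu>"
  obtains G :: "('a::topological_space \<Rightarrow> real) set" and e where "finite G" "0 < e"
    "\<And>g. g \<in> G \<Longrightarrow> continuous_on UNIV g"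
    "\<And>\<nu>. \<nu> \<in> borel_probs \<Longrightarrow> (\<And>g. g \<in> G \<Longrightarrow> \<bar>(\<integral>x. g x \<partial>\<nu>) - (\<integral>x. g x \<partial>\<mu>)\<bar> < e) \<Longrightarrow> \<nu> \<in> F"
proof -
  define basic where "basic U G e \<longleftrightarrow> finite G \<and> 0 < e \<and> (\<forall>g\<in>G. continuous_on UNIV g) \<and>
    (\<forall>\<nu>\<in>borel_probs. (\<forall>g\<in>G. \<bar>(\<integral>x. g x \<partial>\<nu>) - (\<integral>x. g x \<partial>\<mu>)\<bar> < e) \<longrightarrow> \<nu> \<in> U)"
    for U and G :: "('a \<Rightarrow> real) set" and e :: real
  obtain U where U: "openin weak_star_topology U" "\<mu> \<in> U" "U \<subseteq> F"
    using assms by (auto simp: nbhds_of_def)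
  from U(1) have "generate_topology_on
     {{\<nu> \<in> borel_probs. (\<integral>x. g x \<partial>\<nu>) \<in> U} | (g :: 'a \<Rightarrow> real) U. continuous_on UNIV g \<and> open U} U"
    unfolding weak_star_topology_def by (rule openin_topology_generated_by)
  then have "\<mu> \<in> U \<Longrightarrow> \<exists>G e. basic U G e"
  proof (induction rule: generate_topology_on.induct)
    case (Int U V)
    then obtain G d H e where "basic U G d" "basic V H e" by blast
    then have "basic (U \<inter> V) (G \<union> H) (min d e)" by (auto simp: basic_def)
    then show ?case by blast
  next
    case (UN K)
    then obtain U where U: "U \<in> K" "\<mu> \<in> U" by blast
    obtain G e where "basic U G e" using UN.IH[OF U] by blast
    with U have "basic (\<Union>K) G e" unfolding basic_def by blast
    then show ?case by blast
  next
    case (Basis V)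
    then obtain g :: "'a \<Rightarrow> real" and W where V: "V = {\<nu> \<in> borel_probs. (\<integral>x. g x \<partial>\<nu>) \<in> W}"
      and g: "continuous_on UNIV g" "open W" by blast
    with Basis obtain e where "0 < e" "\<And>y. dist y (\<integral>x. g x \<partial>\<mu>) < e \<Longrightarrow> y \<in> W"
      unfolding open_dist by blast
    then have "basic V {g} e" using V g by (auto simp: basic_def dist_real_def)
    then show ?case by blast
  qed simp
  then obtain G e where "basic U G e" using U(2) by blast
  then show ?thesis using U(3) by (intro that[of G e]) (auto simp: basic_def)
qed

lemma nbhds_ofI:
  fixes \<mu> :: "'a::topological_space measure" and G :: "('a \<Rightarrow> real) set"
  assumes "\<mu> \<in> borel_probs" "finite G" "\<And>g. g \<in> G \<Longrightarrow> continuous_on UNIV g"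
    and e: "0 < e"
  shows "{\<nu> \<in> borel_probs. \<forall>g\<in>G. (\<integral>x. g x \<partial>\<nu>) < (\<integral>x. g x \<partial>\<mu>) + e} \<in> nbhds_of \<mu>"
proof -
  let ?V = "\<lambda>g. {\<nu> \<in> borel_probs. (\<integral>x. g x \<partial>\<nu>) \<in> {..<(\<integral>x. g x \<partial>\<mu>) + e}}"
  have sub: "openin weak_star_topology {\<nu> \<in> borel_probs. (\<integral>x. g x \<partial>\<nu>) \<in> W}"
    if "continuous_on UNIV g" "open W" for g :: "'a \<Rightarrow> real" and W
    unfolding weak_star_topology_def using that by (intro topology_generated_by_Basis) blast
  have univ: "openin weak_star_topology (borel_probs :: 'a measure set)"
    using sub[of "\<lambda>_. 0" UNIV] by simp
  have V: "openin weak_star_topology (?V g)" if "g \<in> G" for g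
    by (rule sub) (use assms(3) that in auto)
  have "openin weak_star_topology (\<Inter>g\<in>G. ?V g)" if "G \<noteq> {}"
    by (rule openin_Inter) (use V assms(2) that in auto)
  \<comment> \<open>The intersection over an empty \<open>G\<close> would be the set of all measures
    rather than \<open>borel_probs\<close>.\<close>
  moreover have "{\<nu> \<in> borel_probs. \<forall>g\<in>G. (\<integral>x. g x \<partial>\<nu>) < (\<integral>x. g x \<partial>\<mu>) + e}
      = (if G = {} then borel_probs else (\<Inter>g\<in>G. ?V g))"
    by auto
  ultimately have "openin weak_star_topology {\<nu> \<in> borel_probs. \<forall>g\<in>G. (\<integral>x. g x \<partial>\<nu>) < (\<integral>x. g x \<partial>\<mu>) + e}"
    using univ by auto
  then show ?thesis
    using assms(1) e unfolding nbhds_of_def by auto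
qed

text \<open>As the law of the orbit point at a uniformly chosen time, the empirical measure turns
  integrals into Birkhoff averages by change of variables.\<close>

lemma empirical_measure_eq_distr:
  assumes "0 < n"
  shows "empirical_measure f n x = distr (measure_pmf (pmf_of_set {..<n})) borel (\<lambda>i. (f ^^ i) x)"
proof (rule measure_eqI)
  fix A assume "A \<in> sets (empirical_measure f n x)"
  then have A: "A \<in> sets borel" by simp
  have "(\<Sum>k<n. indicator A ((f ^^ k) x) :: ennreal) = of_nat (card ({..<n} \<inter> (\<lambda>i. (f ^^ i) x) -` A))"
    by (simp add: indicator_def sum.If_cases vimage_def)
  then show "emeasure (empirical_measure f n x) A
      = emeasure (distr (measure_pmf (pmf_of_set {..<n})) borel (\<lambda>i. (f ^^ i) x)) A"
    using A assms
    by (simp add: emeasure_empirical_measure emeasure_distr emeasure_pmf_of_set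
        lessThan_empty_iff ennreal_of_nat_eq_real_of_nat divide_ennreal)
qed simp

lemma empirical_measure_in_borel_probs: "0 < n \<Longrightarrow> empirical_measure f n x \<in> borel_probs"
  by (simp add: borel_probs_def empirical_measure_eq_distr measure_pmf.prob_space_distr)

lemma integral_empirical_measure:
  fixes g :: "'a::topological_space \<Rightarrow> real"
  assumes "0 < n" "continuous_on UNIV g"
  shows "(\<integral>y. g y \<partial>empirical_measure f n x) = birkhoff_sum f g n x / real n"
  using assms borel_measurable_continuous_onI[OF assms(2)]
  by (simp add: empirical_measure_eq_distr integral_distr integral_pmf_of_set lessThan_empty_iff
      birkhoff_sum_def)

section \<open>The upper bound\<close>

context invariant_system
begin

text \<open>Weak-star neighbourhoods control only continuous functions, while functions of names may
  jump at cell boundaries. \<open>g k\<close> is the least \<open>k\<close>-Lipschitz majorant of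
  \<open>u\<close> and converges to \<open>u\<close> at its continuity points.\<close>

lemma continuous_above:
  fixes u :: "'a \<Rightarrow> real"
  assumes [measurable]: "u \<in> borel_measurable borel" and B: "\<And>x. \<bar>u x\<bar> \<le> B"
    and cont: "AE x in \<mu>. isCont u x" and "0 < \<eta>"
  obtains g where "continuous_on UNIV g" "\<And>x. u x \<le> g x" "(\<integral>x. g x \<partial>\<mu>) < (\<integral>x. u x \<partial>\<mu>) + \<eta>"
proof -
  define g where "g k x = (SUP y. u y - real k * dist x y)" for k x
  have le_B: "u y - real k * dist x y \<le> B" for k x y
    using B[of y] zero_le_dist[of x y] by (smt (verit) mult_nonneg_nonneg of_nat_0_le_iff)
  have upper: "u y - real k * dist x y \<le> g k x" for k x y
    unfolding g_def by (rule cSUP_upper) (use le_B in \<open>auto intro!: bdd_aboveI[of _ B]\<close>)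
  have g_le: "g k x \<le> C" if "\<And>y. u y - real k * dist x y \<le> C" for k x C
    unfolding g_def by (rule cSUP_least) (use that in auto)
  have u_le: "u x \<le> g k x" for k x
    using upper[of x k x] by simp
  have lip: "g k x \<le> g k z + real k * dist x z" for k x z
  proof (rule g_le)
    fix y
    have "dist z y \<le> dist x z + dist x y"
      by (metis dist_commute dist_triangle)
    then have "real k * dist z y \<le> real k * dist x z + real k * dist x y"
      by (metis distrib_left mult_left_mono of_nat_0_le_iff)
    with upper[of y k z] show "u y - real k * dist x y \<le> g k z + real k * dist x z"
      by linarith
  qed
  have cont_g: "continuous_on UNIV (g k)" for k
  proof (rule lipschitz_on_continuous_on)
    show "(real k)-lipschitz_on UNIV (g k)"
    proof (rule lipschitz_onI)
      fix x y show "dist (g k x) (g k y) \<le> real k * dist x y"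
        using lip[of k x y] lip[of k y x] by (simp add: dist_real_def abs_le_iff dist_commute)
    qed simp
  qed
  have [measurable]: "g k \<in> borel_measurable borel" for k
    by (rule borel_measurable_continuous_onI[OF cont_g])
  have lim: "(\<lambda>k. g k x) \<longlonglongrightarrow> u x" if x: "isCont u x" for x
  proof (rule order_tendstoI)
    fix a assume "a < u x"
    then show "\<forall>\<^sub>F k in sequentially. a < g k x"
      using u_le less_le_trans by (intro always_eventually) blast
  next
    fix a assume "u x < a"
    then obtain b where b: "u x < b" "b < a" using dense by blast
    then obtain d where d: "0 < d" "\<And>y. dist y x < d \<Longrightarrow> u y < b"
      using x[THEN isContD, THEN order_tendstoD(2), of b]
      by (auto simp: eventually_at) (metis dist_self)
    \<comment> \<open>Beyond distance \<open>d\<close> the penalty exceeds \<open>B - b\<close>, so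
      distant points cannot push the supremum above \<open>b\<close>.\<close>
    obtain N :: nat where N: "B - b < real N * d"
      using reals_Archimedean3[OF d(1)] by blast
    have "g k x \<le> b" if "N \<le> k" for k
    proof (rule g_le)
      fix y show "u y - real k * dist x y \<le> b"
      proof (cases "dist y x < d")
        case True
        then show ?thesis using d(2)[of y] zero_le_dist[of x y]
          by (smt (verit) mult_nonneg_nonneg of_nat_0_le_iff)
      next
        case False
        then have "real N * d \<le> real k * dist x y"
          using that d(1) by (intro mult_mono) (auto simp: dist_commute)
        then show ?thesis using B[of y] N by linarith
      qed
    qed
    then show "\<forall>\<^sub>F k in sequentially. g k x < a"
      using b(2) unfolding eventually_sequentially by (meson le_less_trans)
  qed
  have "(\<lambda>k. \<integral>x. g k x \<partial>\<mu>) \<longlonglongrightarrow> (\<integral>x. u x \<partial>\<mu>)"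
  proof (rule integral_dominated_convergence[where w = "\<lambda>_. B"])
    show "AE x in \<mu>. (\<lambda>k. g k x) \<longlonglongrightarrow> u x"
      using cont by eventually_elim (rule lim)
    show "AE x in \<mu>. norm (g k x) \<le> B" for k
    proof (rule AE_I2)
      fix x show "norm (g k x) \<le> B"
        using B[of x] u_le[of x k] g_le[OF le_B, of k x] by (auto simp: abs_le_iff)
    qed
  qed auto
  then have "\<forall>\<^sub>F k in sequentially. (\<integral>x. g k x \<partial>\<mu>) < (\<integral>x. u x \<partial>\<mu>) + \<eta>"
    by (rule order_tendstoD(2)) (use \<open>0 < \<eta>\<close> in simp)
  then obtain k where "(\<integral>x. g k x \<partial>\<mu>) < (\<integral>x. u x \<partial>\<mu>) + \<eta>"
    by (auto simp: eventually_sequentially)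
  then show ?thesis
    using that[of "g k"] cont_g u_le by blast
qed

text \<open>Spheres of different radii around \<open>x\<close> are disjoint, so only countably many
  carry mass: their radii are the atoms of the law of the distance to \<open>x\<close>.\<close>

lemma null_sphere:
  assumes "0 < \<epsilon>"
  obtains r where "0 < r" "r < \<epsilon>" "sphere x r \<in> null_sets \<mu>"
proof -
  have [measurable]: "(\<lambda>y. dist x y) \<in> borel_measurable borel"
    by (intro borel_measurable_continuous_onI continuous_intros)
  interpret D: prob_space "distr \<mu> borel (\<lambda>y. dist x y)"
    by (rule prob_space_distr) simp
  have "countable {r. D.prob {r} \<noteq> 0}"
    by (rule D.countable_support)
  moreover have "uncountable {0<..<\<epsilon>}"
    using assms by (simp add: uncountable_open_interval)
  ultimately obtain r where r: "r \<in> {0<..<\<epsilon>}" "D.prob {r} = 0"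
    by (metis (mono_tags, lifting) countable_subset mem_Collect_eq subsetI)
  have vimage: "(\<lambda>y. dist x y) -` {r} = sphere x r"
    by (auto simp: sphere_def)
  then have "prob (sphere x r) = 0" using r(2)
    by (simp add: measure_distr)
  then show ?thesis
    using r(1) vimage measurable_sets[of "\<lambda>y. dist x y" borel borel "{r}"]
    by (intro that[of r]) (auto simp: null_sets_def emeasure_eq_measure)
qed

text \<open>Finitely many balls with null spheres cover the space, and each point is labelled by the
  first ball containing it. Off these spheres the label is locally constant.\<close>

lemma null_boundary_partition:
  assumes compact: "compact (UNIV :: 'a set)" and "0 < \<epsilon>"
  obtains \<xi> where "finite_borel_partition \<xi>"
    "\<And>x y. cell \<xi> x = cell \<xi> y \<Longrightarrow> dist x y \<le> \<epsilon>"
    "AE x in \<mu>. \<forall>\<^sub>F y in nhds x. cell \<xi> y = cell \<xi> x"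
proof -
  have "\<exists>r. 0 < r \<and> r < \<epsilon> / 2 \<and> sphere x r \<in> null_sets \<mu>" for x
    using null_sphere[of "\<epsilon> / 2" x] \<open>0 < \<epsilon>\<close> by (metis half_gt_zero)
  then obtain r where r: "\<And>x. 0 < r x" "\<And>x. r x < \<epsilon> / 2" "\<And>x. sphere x (r x) \<in> null_sets \<mu>"
    by metis
  obtain D where D: "finite D" "UNIV \<subseteq> (\<Union>x\<in>D. ball x (r x))"
    by (rule compactE_image[OF compact, of UNIV "\<lambda>x. ball x (r x)"]) (use r(1) in auto)
  obtain ds where ds: "set ds = D"
    using finite_list[OF D(1)] by blast
  define in_ball where "in_ball i y \<longleftrightarrow> i < length ds \<and> y \<in> ball (ds ! i) (r (ds ! i))" for i y
  define c where "c y = (LEAST i. in_ball i y)" for y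
  have "\<exists>i. in_ball i y" for y
    using D(2) ds unfolding in_ball_def by (metis UNIV_I UN_E in_set_conv_nth subsetD)
  then have c: "in_ball (c y) y" for y
    unfolding c_def by (meson LeastI)
  have [measurable]: "Measurable.pred borel (in_ball i)" for i
  proof -
    have "{y. in_ball i y} = (if i < length ds then ball (ds ! i) (r (ds ! i)) else {})"
      by (auto simp: in_ball_def)
    then show ?thesis by (simp add: pred_def)
  qed
  have "c \<in> measurable borel (count_space UNIV)"
    unfolding c_def by measurable
  then have meas: "c -` {i} \<in> sets borel" for i
    using measurable_sets[of c borel "count_space UNIV" "{i}"] by simp
  define \<xi> where "\<xi> = (\<lambda>i. c -` {i}) ` range c"
  have part: "partition_on UNIV \<xi>"
    unfolding \<xi>_def by (rule partition_onI) (auto simp: disjnt_def)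
  have "range c \<subseteq> {..<length ds}"
    using c unfolding in_ball_def by auto
  then have fin: "finite_borel_partition \<xi>"
    using part meas finite_subset[of "range c" "{..<length ds}"]
    by (auto simp: finite_borel_partition_def \<xi>_def)
  have cell: "cell \<xi> x = c -` {c x}" for x
    by (rule cell_eq[OF part]) (auto simp: \<xi>_def)
  have cell_iff: "cell \<xi> x = cell \<xi> y \<longleftrightarrow> c x = c y" for x y
    unfolding cell by auto
  have diam: "dist x y \<le> \<epsilon>" if "c x = c y" for x y
  proof -
    let ?z = "ds ! c x"
    have "dist ?z x < \<epsilon> / 2" "dist ?z y < \<epsilon> / 2"
      using c[of x] c[of y] that r(2)[of ?z] unfolding in_ball_def by auto
    then show ?thesis
      using dist_triangle[of x y ?z] by (simp add: dist_commute)
  qed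
  have "AE x in \<mu>. \<forall>z\<in>D. x \<notin> sphere z (r z)"
    using r(3) D(1) by (intro AE_finite_allI AE_not_in)
  then have "AE x in \<mu>. \<forall>\<^sub>F y in nhds x. c y = c x"
  proof eventually_elim
    case (elim x)
    have "\<forall>\<^sub>F y in nhds x. in_ball i y \<longleftrightarrow> in_ball i x" if i: "i < length ds" for i
    proof -
      let ?z = "ds ! i"
      have lim: "((\<lambda>y. dist ?z y) \<longlongrightarrow> dist ?z x) (nhds x)"
        by (intro tendsto_intros filterlim_ident)
      have "dist ?z x \<noteq> r ?z"
        using elim i ds by auto
      then consider "dist ?z x < r ?z" | "r ?z < dist ?z x" by linarith
      then show ?thesis
      proof cases
        case 1
        from order_tendstoD(2)[OF lim 1] show ?thesis
          by eventually_elim (use 1 i in \<open>simp add: in_ball_def\<close>)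
      next
        case 2
        from order_tendstoD(1)[OF lim 2] show ?thesis
          by eventually_elim (use 2 i in \<open>simp add: in_ball_def\<close>)
      qed
    qed
    then have "\<forall>\<^sub>F y in nhds x. \<forall>i\<in>{..<length ds}. in_ball i y \<longleftrightarrow> in_ball i x"
      by (intro eventually_ball_finite) auto
    then show ?case
    proof eventually_elim
      case (elim y)
      then have "in_ball i y \<longleftrightarrow> in_ball i x" for i
        by (cases "i < length ds") (auto simp: in_ball_def)
      then show ?case by (simp add: c_def)
    qed
  qed
  then show ?thesis
    using fin diam by (intro that[of \<xi>]) (auto simp: cell_iff)
qed

lemma AE_comp_funpow:
  assumes "AE x in \<mu>. P x"
  shows "AE x in \<mu>. P ((f ^^ i) x)"
proof (induction i)
  case (Suc i)
  have "f \<in> measurable \<mu> borel" by measurable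
  moreover have "AE x in distr \<mu> borel f. P ((f ^^ i) x)"
    by (subst distr_f) (rule Suc)
  ultimately have "AE x in \<mu>. P ((f ^^ i) (f x))"
    by (rule AE_distrD)
  then show ?case by (simp add: funpow_swap1)
qed (use assms in simp)

end

section \<open>Markov weights on words\<close>

context coded_system
begin

definition alphabet_size :: real where
  "alphabet_size = real (card (range c))"

lemma alphabet_size_ge_1: "1 \<le> alphabet_size"
proof -
  have "card (range c) \<noteq> 0"
    using finite_range_c by auto
  then show ?thesis by (simp add: alphabet_size_def)
qed

lemma card_words: "real (card (words m)) = alphabet_size ^ m"
  unfolding words_def alphabet_size_def using card_lists_length_eq[OF finite_range_c] by simp

text \<open>Summing over the preceding letter gives the preimage of a cylinder, whose measure is
  unchanged by invariance. This normalises transitions that prepend a letter.\<close>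

lemma sum_word_prob_Cons: "(\<Sum>a\<in>range c. word_prob (a # w)) = word_prob w"
proof -
  have "f -` cylinder w = (\<Union>a\<in>range c. cylinder (a # w))"
    by (auto simp: cylinder_Cons)
  moreover have "prob (\<Union>a\<in>range c. cylinder (a # w)) = (\<Sum>a\<in>range c. word_prob (a # w))"
    unfolding word_prob_def
  proof (rule finite_measure_finite_Union)
    show "disjoint_family_on (\<lambda>a. cylinder (a # w)) (range c)"
      unfolding disjoint_family_on_def cylinder_Cons by auto
  qed (auto simp: finite_range_c)
  ultimately show ?thesis
    using prob_vimage_funpow[of "cylinder w" 1] by (simp add: word_prob_def)
qed

lemma comp_name_bounded:
  fixes g :: "'b list \<Rightarrow> real"
  shows "\<bar>g (name n x)\<bar> \<le> (\<Sum>w\<in>words n. \<bar>g w\<bar>)"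
  by (rule member_le_sum[where f = "\<lambda>w. \<bar>g w\<bar>"]) auto

text \<open>Transition probabilities of the Markov chain of memory \<open>m\<close> that matches the word
  frequencies, read backwards in time. The smoothing by \<open>s\<close> keeps them positive, so that their
  logarithms are bounded.\<close>

definition transition :: "real \<Rightarrow> 'b \<Rightarrow> 'b list \<Rightarrow> real" where
  "transition s a w = (word_prob (a # w) + s) / (word_prob w + alphabet_size * s)"

lemma transition_pos: "0 < s \<Longrightarrow> 0 < transition s a w"
  unfolding transition_def using alphabet_size_ge_1 word_prob_nonneg
  by (intro divide_pos_pos add_nonneg_pos mult_pos_pos) auto

lemma sum_transition:
  assumes "0 < s" shows "(\<Sum>a\<in>range c. transition s a w) = 1"
proof -
  have "0 < word_prob w + alphabet_size * s"
    using assms alphabet_size_ge_1 word_prob_nonneg by (intro add_nonneg_pos mult_pos_pos) auto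
  then show ?thesis
    unfolding transition_def
    by (simp add: sum.distrib sum_word_prob_Cons alphabet_size_def flip: sum_divide_distrib)
qed

text \<open>The last \<open>m\<close> letters carry no factor: the chain starts from counting
  measure on words of length \<open>m\<close>, so the total mass is their number rather than
  1.\<close>

primrec markov_weight :: "real \<Rightarrow> nat \<Rightarrow> 'b list \<Rightarrow> real" where
  "markov_weight s m [] = 1"
| "markov_weight s m (a # w) = (if m \<le> length w then transition s a (take m w) else 1) * markov_weight s m w"

lemma markov_weight_short: "length w \<le> m \<Longrightarrow> markov_weight s m w = 1"
  by (induction w) auto

text \<open>A prepended letter leaves the total mass unchanged because its transitions sum to 1.
  Being constant in \<open>n\<close>, the mass does not affect exponential growth rates.\<close>

lemma sum_markov_weight:
  assumes "0 < s" shows "(\<Sum>w\<in>words (n + m). markov_weight s m w) = alphabet_size ^ m"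
proof (induction n)
  case 0
  have "(\<Sum>w\<in>words m. markov_weight s m w) = (\<Sum>w\<in>words m. 1)"
    by (intro sum.cong refl markov_weight_short) (simp add: words_def)
  then show ?case by (simp add: card_words)
next
  case (Suc n)
  have "(\<Sum>w\<in>words (Suc n + m). markov_weight s m w)
      = (\<Sum>w\<in>words (n + m). \<Sum>a\<in>range c. transition s a (take m w) * markov_weight s m w)"
    by (simp add: sum_words_Suc) (intro sum.cong refl, simp add: words_def)
  also have "\<dots> = (\<Sum>w\<in>words (n + m). markov_weight s m w)"
    using assms by (simp add: sum_transition flip: sum_distrib_right)
  finally show ?case using Suc by simp
qed

text \<open>The conditional information of the current letter given the next \<open>m\<close>
  letters, computed from the smoothed probabilities.\<close>

definition information :: "real \<Rightarrow> nat \<Rightarrow> 'a \<Rightarrow> real" where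
  "information s m x = - ln (transition s (c x) (name m (f x)))"

lemma information_name:
  "information s m x = (\<lambda>w. - ln (transition s (hd w) (tl w))) (name (Suc m) x)"
  by (simp add: information_def name_Suc)

lemma measurable_information: "information s m \<in> borel_measurable borel"
proof -
  have "information s m = (\<lambda>x. (\<lambda>w. - ln (transition s (hd w) (tl w))) (name (Suc m) x))"
    by (rule ext) (rule information_name)
  then show ?thesis
    using measurable_comp_name[of "\<lambda>w. - ln (transition s (hd w) (tl w))" "Suc m"] by (simp only:)
qed

text \<open>The \<open>m\<close> extra letters supply the memory for the first \<open>n\<close>
  positions, so exactly these positions carry a factor.\<close>

lemma markov_weight_name:
  assumes "0 < s"
  shows "markov_weight s m (name (n + m) x) = exp (- birkhoff_sum f (information s m) n x)"
proof (induction n arbitrary: x)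
  case 0
  then show ?case by (simp add: markov_weight_short birkhoff_sum_def)
next
  case (Suc n)
  have "markov_weight s m (name (Suc n + m) x)
      = transition s (c x) (take m (name (n + m) (f x))) * markov_weight s m (name (n + m) (f x))"
    by (simp add: name_Suc)
  also have "take m (name (n + m) (f x)) = name m (f x)"
    using take_name[of m n] by (simp add: add.commute)
  also have "transition s (c x) (name m (f x)) = exp (- information s m x)"
    using transition_pos[OF assms] by (simp add: information_def)
  finally show ?case
    unfolding Suc by (simp add: birkhoff_sum_Suc flip: exp_add)
qed

text \<open>Dropping \<open>s\<close> from the numerator only increases \<open>- ln\<close>. The
  rest splits into the entropy of \<open>m + 1\<close> letters and, after summing over the first
  letter, a term that tends to \<open>- name_entropy m\<close> as \<open>s\<close> tends to
  0.\<close>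

lemma information_integral_le:
  assumes "0 < s"
  shows "(\<integral>x. information s m x \<partial>\<mu>)
    \<le> name_entropy (Suc m) + (\<Sum>w\<in>words m. word_prob w * ln (word_prob w + alphabet_size * s))"
proof -
  have step: "word_prob (a # w) * - ln (transition s a w)
      \<le> - (word_prob (a # w) * ln (word_prob (a # w)))
        + word_prob (a # w) * ln (word_prob w + alphabet_size * s)" for a w
  proof (cases "word_prob (a # w) = 0")
    case False
    then have pos: "0 < word_prob (a # w)"
      using word_prob_nonneg[of "a # w"] by linarith
    have "0 < word_prob w + alphabet_size * s"
      using assms alphabet_size_ge_1 word_prob_nonneg by (intro add_nonneg_pos mult_pos_pos) auto
    then have "- ln (transition s a w)
        = ln (word_prob w + alphabet_size * s) - ln (word_prob (a # w) + s)"
      using pos assms by (simp add: transition_def ln_div)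
    also have "\<dots> \<le> ln (word_prob w + alphabet_size * s) - ln (word_prob (a # w))"
      using pos assms by simp
    finally have "word_prob (a # w) * - ln (transition s a w)
        \<le> word_prob (a # w) * (ln (word_prob w + alphabet_size * s) - ln (word_prob (a # w)))"
      by (rule mult_left_mono) simp
    then show ?thesis by (simp add: algebra_simps)
  qed simp
  have "(\<integral>x. information s m x \<partial>\<mu>)
      = (\<Sum>w\<in>words m. \<Sum>a\<in>range c. word_prob (a # w) * - ln (transition s a w))"
    unfolding information_name
    by (subst expectation_name) (simp only: sum_words_Suc list.sel)
  also have "\<dots> \<le> (\<Sum>w\<in>words m. \<Sum>a\<in>range c. - (word_prob (a # w) * ln (word_prob (a # w)))
        + word_prob (a # w) * ln (word_prob w + alphabet_size * s))"
    by (intro sum_mono step)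
  also have "\<dots> = name_entropy (Suc m) + (\<Sum>w\<in>words m. word_prob w * ln (word_prob w + alphabet_size * s))"
    by (simp add: name_entropy_def sum_words_Suc sum.distrib sum_negf sum_subtractf sum_word_prob_Cons
        flip: sum_distrib_right)
  finally show ?thesis .
qed

text \<open>As \<open>s\<close> tends to 0, words of positive probability are handled by continuity,
  and null words contribute 0 for every \<open>s\<close> although their logarithms diverge.\<close>

lemma information_integral_approx:
  assumes "0 < \<eta>"
  obtains s where "0 < s" "(\<integral>x. information s m x \<partial>\<mu>) < name_entropy (Suc m) - name_entropy m + \<eta>"
proof -
  let ?h = "\<lambda>s. \<Sum>w\<in>words m. word_prob w * ln (word_prob w + alphabet_size * s)"
  have "((\<lambda>s. word_prob w * ln (word_prob w + alphabet_size * s)) \<longlongrightarrow> word_prob w * ln (word_prob w))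
      (at_right 0)" for w
  proof (cases "word_prob w = 0")
    case False
    then have "((\<lambda>s. word_prob w * ln (word_prob w + alphabet_size * s))
        \<longlongrightarrow> word_prob w * ln (word_prob w + alphabet_size * 0)) (at_right 0)"
      by (intro tendsto_intros) auto
    then show ?thesis by simp
  qed simp
  then have "(?h \<longlongrightarrow> (\<Sum>w\<in>words m. word_prob w * ln (word_prob w))) (at_right 0)"
    by (intro tendsto_sum)
  then have "(?h \<longlongrightarrow> - name_entropy m) (at_right 0)"
    by (simp add: name_entropy_def)
  then have "\<forall>\<^sub>F s in at_right 0. ?h s < - name_entropy m + \<eta>"
    by (rule order_tendstoD(2)) (use assms in simp)
  moreover have "\<forall>\<^sub>F s in at_right 0. 0 < (s :: real)"
    by (rule eventually_at_right_less)
  ultimately have "\<forall>\<^sub>F s in at_right 0. 0 < s \<and> ?h s < - name_entropy m + \<eta>"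
    by eventually_elim simp
  from eventually_happens'[OF trivial_limit_at_right_real this]
  obtain s where s: "0 < s" "?h s < - name_entropy m + \<eta>"
    by blast
  show ?thesis
    using that[OF s(1)] s(2) information_integral_le[OF s(1), of m] by linarith
qed

text \<open>If every increment were at least \<open>entropy_rate + \<eta>\<close>, telescoping from
  \<open>name_entropy_0\<close> would contradict the rate.\<close>

lemma entropy_increment_approx:
  assumes "0 < \<eta>"
  obtains m where "name_entropy (Suc m) - name_entropy m < entropy_rate + \<eta>"
proof (rule ccontr)
  assume "\<not> thesis"
  then have incr: "name_entropy m + (entropy_rate + \<eta>) \<le> name_entropy (Suc m)" for m
    using that[of m] by linarith
  have "real n * (entropy_rate + \<eta>) \<le> name_entropy n" for n
  proof (induction n)
    case (Suc n)
    then show ?case using incr[of n] by (simp add: algebra_simps)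
  qed (simp add: name_entropy_0)
  then have "entropy_rate + \<eta> \<le> name_entropy n / real n" if "1 \<le> n" for n
    using that by (simp add: field_simps)
  then have "entropy_rate + \<eta> \<le> entropy_rate"
    using LIMSEQ_le_const[OF entropy_rate_LIMSEQ] by blast
  with assms show False by simp
qed

text \<open>For almost every point, the first \<open>m + 1\<close> orbit points lie in the interior
  of their cells. Continuity of the iterates then makes the name of length \<open>m + 1\<close>
  locally constant.\<close>

lemma information_isCont_AE:
  assumes "continuous_on UNIV f" "AE x in \<mu>. \<forall>\<^sub>F y in nhds x. c y = c x"
  shows "AE x in \<mu>. isCont (information s m) x"
proof -
  have "AE x in \<mu>. \<forall>i\<in>{..m}. \<forall>\<^sub>F y in nhds ((f ^^ i) x). c y = c ((f ^^ i) x)"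
    by (intro AE_finite_allI AE_comp_funpow[where P = "\<lambda>x. \<forall>\<^sub>F y in nhds x. c y = c x"] assms(2)) simp
  then show ?thesis
  proof eventually_elim
    case (elim x)
    have cont: "continuous_on UNIV (f ^^ i)" for i
    proof (induction i)
      case (Suc i)
      then show ?case using continuous_on_compose[of UNIV "f ^^ i" f] assms(1)
        by (simp add: continuous_on_subset o_def)
    qed (simp add: id_def)
    have "\<forall>\<^sub>F y in nhds x. c ((f ^^ i) y) = c ((f ^^ i) x)" if "i \<le> m" for i
    proof -
      have "filterlim (f ^^ i) (nhds ((f ^^ i) x)) (nhds x)"
        using cont[of i] by (simp add: continuous_on_eq_continuous_at isCont_def tendsto_at_iff_tendsto_nhds)
      moreover have "\<forall>\<^sub>F y in nhds ((f ^^ i) x). c y = c ((f ^^ i) x)"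
        using elim that by blast
      ultimately show ?thesis
        by (rule eventually_compose_filterlim[rotated])
    qed
    then have "\<forall>\<^sub>F y in nhds x. \<forall>i\<in>{..m}. c ((f ^^ i) y) = c ((f ^^ i) x)"
      by (intro eventually_ball_finite) auto
    then have "\<forall>\<^sub>F y in nhds x. information s m y = information s m x"
    proof eventually_elim
      case (elim y)
      then have "name (Suc m) y = name (Suc m) x"
        by (simp add: name_eq_iff less_Suc_eq_le)
      then show ?case by (simp only: information_name)
    qed
    then have "\<forall>\<^sub>F y in at x. information s m y = information s m x"
      unfolding eventually_nhds_conv_at by blast
    then show ?case
      unfolding isCont_def by (rule tendsto_eventually)
  qed
qed

text \<open>Equal names keep two orbits within \<open>\<epsilon>\<close> for \<open>n\<close> steps,
  contrary to strict separation. Longer names are allowed because the Markov weights live on words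
  of length \<open>n + m\<close>.\<close>

lemma name_inj_on_separated:
  assumes sep: "separated f n \<epsilon> E" and n: "0 < n" "n \<le> N"
    and diam: "\<And>x y. c x = c y \<Longrightarrow> dist x y \<le> \<epsilon>"
  shows "inj_on (name N) E"
proof (rule inj_onI, rule ccontr)
  fix x y assume xy: "x \<in> E" "y \<in> E" "name N x = name N y" "x \<noteq> y"
  then have "dist ((f ^^ i) x) ((f ^^ i) y) \<le> \<epsilon>" if "i < n" for i
    using that n diam by (auto simp: name_eq_iff)
  then have "bowen_dist f n x y \<le> \<epsilon>"
    unfolding bowen_dist_def using n by (subst Max_le_iff) auto
  with sep xy show False by (force simp: separated_def)
qed

end

section \<open>Separated sets against Markov weights\<close>

lemma ext_ln_ennreal: "0 < r \<Longrightarrow> ext_ln (ennreal r) = ereal (ln r)"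
  by (simp add: ext_ln_def)

text \<open>Each point of a separated set is charged to the Markov weight of its own word. Empirical
  measures in \<open>F\<close> bound these weights from below and the Birkhoff sums of
  \<open>\<phi>\<close> from above, while the total weight is bounded in \<open>n\<close>.\<close>

lemma (in invariant_system) INF_limsup_P_sep_le_partition:
  assumes compact: "compact (UNIV :: 'a set)" and f: "continuous_on UNIV f"
    and \<phi>: "continuous_on UNIV \<phi>" and "0 < \<epsilon>" "0 < \<eta>"
  obtains \<xi> where "finite_borel_partition \<xi>"
    "(INF F\<in>nbhds_of \<mu>. limsup (\<lambda>n. ereal (1 / real n) * ext_ln (P_sep f F \<phi> n \<epsilon>)))
      \<le> ereal (entropy_wrt_partition \<mu> f \<xi> + (\<integral>x. \<phi> x \<partial>\<mu>) + 5 * \<eta>)"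
proof -
  obtain \<xi> where \<xi>: "finite_borel_partition \<xi>"
    and diam: "\<And>x y. cell \<xi> x = cell \<xi> y \<Longrightarrow> dist x y \<le> \<epsilon>"
    and bdry: "AE x in \<mu>. \<forall>\<^sub>F y in nhds x. cell \<xi> y = cell \<xi> x"
    using null_boundary_partition[OF compact \<open>0 < \<epsilon>\<close>] by blast
  interpret coded_system f \<mu> "cell \<xi>"
    by (rule coded_system_cell[OF \<xi>])
  have rate: "entropy_rate = entropy_wrt_partition \<mu> f \<xi>"
    using entropy_wrt_partition_eq[OF coded_system_axioms] \<xi> by (simp add: finite_borel_partition_def)
  obtain m where m: "name_entropy (Suc m) - name_entropy m < entropy_rate + \<eta>"
    using entropy_increment_approx[OF \<open>0 < \<eta>\<close>] by blast
  obtain s where s: "0 < s" "(\<integral>x. information s m x \<partial>\<mu>) < name_entropy (Suc m) - name_entropy m + \<eta>"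
    using information_integral_approx[OF \<open>0 < \<eta>\<close>] by blast
  obtain g where g: "continuous_on UNIV g" "\<And>x. information s m x \<le> g x"
    "(\<integral>x. g x \<partial>\<mu>) < (\<integral>x. information s m x \<partial>\<mu>) + \<eta>"
  proof (rule continuous_above[OF _ _ information_isCont_AE[OF f bdry] \<open>0 < \<eta>\<close>])
    show "information s m \<in> borel_measurable borel"
      by (rule measurable_information)
    show "\<bar>information s m x\<bar> \<le> (\<Sum>w\<in>words (Suc m). \<bar>- ln (transition s (hd w) (tl w))\<bar>)" for x
      unfolding information_name by (rule comp_name_bounded)
  qed blast
  define F where "F = {\<nu> \<in> borel_probs. \<forall>h\<in>{g, \<phi>}. (\<integral>x. h x \<partial>\<nu>) < (\<integral>x. h x \<partial>\<mu>) + \<eta>}"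
  have F: "F \<in> nbhds_of \<mu>"
    unfolding F_def using g(1) \<phi> \<open>0 < \<eta>\<close> mu_in_borel_probs by (intro nbhds_ofI) auto
  define K where "K = (\<integral>x. g x \<partial>\<mu>) + (\<integral>x. \<phi> x \<partial>\<mu>) + 2 * \<eta>"
  \<comment> \<open>The five errors \<open>\<eta>\<close> come from the entropy increment, the
    smoothing, the continuous majorant, and the averages of \<open>g\<close> and
    \<open>\<phi>\<close> over \<open>F\<close>.\<close>
  have K: "K \<le> entropy_wrt_partition \<mu> f \<xi> + (\<integral>x. \<phi> x \<partial>\<mu>) + 5 * \<eta>"
    using m s(2) g(3) unfolding K_def rate by linarith
  have bound: "P_sep f F \<phi> n \<epsilon> \<le> ennreal (alphabet_size ^ m * exp (real n * K))" if n: "0 < n" for n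
    unfolding P_sep_def
  proof (rule SUP_least)
    fix E assume "E \<in> {E. finite E \<and> E \<subseteq> empirical_in f n F \<and> separated f n \<epsilon> E}"
    then have E: "finite E" "E \<subseteq> empirical_in f n F" "separated f n \<epsilon> E" by auto
    have average: "birkhoff_sum f h n x \<le> real n * ((\<integral>x. h x \<partial>\<mu>) + \<eta>)"
      if "x \<in> E" "h \<in> {g, \<phi>}" for x h
    proof -
      have "continuous_on UNIV h" using that g(1) \<phi> by auto
      moreover have "(\<integral>y. h y \<partial>empirical_measure f n x) < (\<integral>x. h x \<partial>\<mu>) + \<eta>"
        using that E(2) unfolding empirical_in_def F_def by blast
      ultimately have "birkhoff_sum f h n x / real n < (\<integral>x. h x \<partial>\<mu>) + \<eta>"
        using integral_empirical_measure[OF n, of h f x] by simp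
      then show ?thesis using n by (simp add: field_simps)
    qed
    have weight: "exp (birkhoff_sum f \<phi> n x) \<le> markov_weight s m (name (n + m) x) * exp (real n * K)"
      if x: "x \<in> E" for x
    proof -
      have "birkhoff_sum f (information s m) n x \<le> birkhoff_sum f g n x"
        unfolding birkhoff_sum_def by (intro sum_mono g(2))
      also have "\<dots> \<le> real n * ((\<integral>x. g x \<partial>\<mu>) + \<eta>)"
        by (rule average) (use x in auto)
      finally have "birkhoff_sum f \<phi> n x \<le> - birkhoff_sum f (information s m) n x + real n * K"
        using average[OF x, of \<phi>] unfolding K_def by (simp add: algebra_simps)
      then show ?thesis
        by (simp add: markov_weight_name[OF s(1)] flip: exp_add)
    qed
    have weight_nonneg: "0 \<le> markov_weight s m w" for w
      by (induction w) (use transition_pos[OF s(1)] in \<open>auto simp: less_imp_le\<close>)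
    have "(\<Sum>x\<in>E. exp (birkhoff_sum f \<phi> n x)) \<le> (\<Sum>x\<in>E. markov_weight s m (name (n + m) x)) * exp (real n * K)"
      unfolding sum_distrib_right by (intro sum_mono weight)
    \<comment> \<open>Distinct points have distinct names, so the sum runs over distinct words and
      can be enlarged to all words.\<close>
    also have "(\<Sum>x\<in>E. markov_weight s m (name (n + m) x)) = (\<Sum>w\<in>name (n + m) ` E. markov_weight s m w)"
      using name_inj_on_separated[OF E(3) n _ diam, of "n + m"] by (simp add: sum.reindex)
    also have "\<dots> * exp (real n * K) \<le> (\<Sum>w\<in>words (n + m). markov_weight s m w) * exp (real n * K)"
      by (intro mult_right_mono sum_mono2) (auto intro: weight_nonneg)
    also have "(\<Sum>w\<in>words (n + m). markov_weight s m w) = alphabet_size ^ m"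
      by (rule sum_markov_weight[OF s(1)])
    finally show "(\<Sum>x\<in>E. ennreal (exp (birkhoff_sum f \<phi> n x))) \<le> ennreal (alphabet_size ^ m * exp (real n * K))"
      by (simp add: ennreal_leI)
  qed
  have L: "0 < alphabet_size"
    using alphabet_size_ge_1 by linarith
  define a where "a n = ln (alphabet_size ^ m) / real n + K" for n
  have "limsup (\<lambda>n. ereal (1 / real n) * ext_ln (P_sep f F \<phi> n \<epsilon>)) \<le> limsup (\<lambda>n. ereal (a n))"
  proof (rule Limsup_mono)
    show "\<forall>\<^sub>F n in sequentially. ereal (1 / real n) * ext_ln (P_sep f F \<phi> n \<epsilon>) \<le> ereal (a n)"
      using eventually_gt_at_top[of 0]
    proof eventually_elim
      case (elim n)
      have "ext_ln (P_sep f F \<phi> n \<epsilon>) \<le> ereal (ln (alphabet_size ^ m * exp (real n * K)))"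
        using ext_ln_mono[OF bound[OF elim]] L by (simp add: ext_ln_ennreal)
      then have "ereal (1 / real n) * ext_ln (P_sep f F \<phi> n \<epsilon>)
          \<le> ereal (1 / real n) * ereal (ln (alphabet_size ^ m * exp (real n * K)))"
        by (rule ereal_mult_left_mono) simp
      also have "ln (alphabet_size ^ m * exp (real n * K)) = ln (alphabet_size ^ m) + real n * K"
        using L by (simp add: ln_mult)
      also have "ereal (1 / real n) * ereal (ln (alphabet_size ^ m) + real n * K) = ereal (a n)"
        using elim by (simp add: a_def field_simps)
      finally show ?case .
    qed
  qed
  also have "\<dots> = ereal K"
  proof (rule lim_imp_Limsup)
    have "a \<longlonglongrightarrow> 0 + K"
      unfolding a_def by (intro tendsto_add lim_const_over_n tendsto_const)
    then show "(\<lambda>n. ereal (a n)) \<longlonglongrightarrow> ereal K" by simp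
  qed simp
  finally have "(INF F\<in>nbhds_of \<mu>. limsup (\<lambda>n. ereal (1 / real n) * ext_ln (P_sep f F \<phi> n \<epsilon>))) \<le> ereal K"
    using F by (meson INF_lower order_trans)
  also have "\<dots> \<le> ereal (entropy_wrt_partition \<mu> f \<xi> + (\<integral>x. \<phi> x \<partial>\<mu>) + 5 * \<eta>)"
    using K by simp
  finally show ?thesis
    using that[OF \<xi>] by blast
qed

text \<open>The partition depends on \<open>\<epsilon>\<close> and \<open>\<eta>\<close>, but its
  entropy is always at most the supremum \<open>KS_entropy\<close>, which may be infinite.\<close>

proposition (in invariant_system) upper_SP_le:
  assumes compact: "compact (UNIV :: 'a set)" and f: "continuous_on UNIV f"
    and \<phi>: "continuous_on UNIV \<phi>"
  shows "upper_SP \<mu> f \<phi> \<le> KS_entropy \<mu> f + ereal (\<integral>x. \<phi> x \<partial>\<mu>)"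
  unfolding SP_eq_SUP
proof (rule SUP_least)
  fix \<epsilon> :: real assume "\<epsilon> \<in> {0<..}"
  then have \<epsilon>: "0 < \<epsilon>" by simp
  show "(INF F\<in>nbhds_of \<mu>. limsup (\<lambda>n. ereal (1 / real n) * ext_ln (P_sep f F \<phi> n \<epsilon>)))
      \<le> KS_entropy \<mu> f + ereal (\<integral>x. \<phi> x \<partial>\<mu>)" (is "?I \<le> _")
  proof (rule ereal_le_epsilon2)
    fix \<eta> :: real assume "0 < \<eta>"
    then have \<eta>: "0 < \<eta> / 5" by simp
    obtain \<xi> where \<xi>: "finite_borel_partition \<xi>"
      "?I \<le> ereal (entropy_wrt_partition \<mu> f \<xi> + (\<integral>x. \<phi> x \<partial>\<mu>) + 5 * (\<eta> / 5))"
      using INF_limsup_P_sep_le_partition[OF compact f \<phi> \<epsilon> \<eta>] by blast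
    have "ereal (entropy_wrt_partition \<mu> f \<xi>) \<le> KS_entropy \<mu> f"
      unfolding KS_entropy_def by (rule SUP_upper) (use \<xi>(1) in simp)
    then have "ereal (entropy_wrt_partition \<mu> f \<xi>) + ereal (\<integral>x. \<phi> x \<partial>\<mu>) + ereal \<eta>
        \<le> KS_entropy \<mu> f + ereal (\<integral>x. \<phi> x \<partial>\<mu>) + ereal \<eta>"
      by (intro add_right_mono)
    with \<xi>(2) show "?I \<le> KS_entropy \<mu> f + ereal (\<integral>x. \<phi> x \<partial>\<mu>) + ereal \<eta>"
      by simp
  qed
qed

section \<open>The lower bound\<close>

context invariant_system
begin

text \<open>The open neighbourhoods of radius \<open>1 / real (Suc n)\<close> decrease to the closed
  set itself, and continuity from above applies.\<close>

lemma closed_outer_approximation: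
  assumes A: "closed A" "0 < e"
  obtains U where "open U" "A \<subseteq> U" "prob (U - A) < e"
proof -
  define U where "U n = (\<Union>x\<in>A. ball x (1 / real (Suc n)))" for n
  have "open (U n)" for n
    unfolding U_def by blast
  have "A \<subseteq> U n" for n
    unfolding U_def by (force simp: dist_self)
  have "y \<in> A" if y: "\<And>n. y \<in> U n" for y
  proof -
    have "\<exists>x\<in>A. dist x y < e" if "0 < e" for e
    proof -
      obtain n where "inverse (real (Suc n)) < e"
        using reals_Archimedean[OF \<open>0 < e\<close>] by blast
      then show ?thesis
        using y[of n] unfolding U_def by (fastforce simp: divide_inverse intro: less_trans)
    qed
    then have "y \<in> closure A"
      by (simp add: closure_approachable)
    with A(1) show ?thesis by simp
  qed
  then have inter: "(\<Inter>n. U n - A) = {}" by blast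
  have "decseq (\<lambda>n. U n - A)"
  proof (rule decseq_SucI)
    fix n
    have "1 / real (Suc (Suc n)) \<le> 1 / real (Suc n)"
      by (simp add: frac_le)
    then have "ball x (1 / real (Suc (Suc n))) \<subseteq> ball x (1 / real (Suc n))" for x :: 'a
      by (rule subset_ball)
    then show "U (Suc n) - A \<subseteq> U n - A"
      unfolding U_def by blast
  qed
  moreover have "range (\<lambda>n. U n - A) \<subseteq> sets \<mu>"
    using \<open>\<And>n. open (U n)\<close> A(1) by (auto intro!: borel_open open_Diff)
  ultimately have "(\<lambda>n. prob (U n - A)) \<longlonglongrightarrow> 0"
    using finite_Lim_measure_decseq[of "\<lambda>n. U n - A"] unfolding inter by simp
  then have "\<forall>\<^sub>F n in sequentially. prob (U n - A) < e"
    by (rule order_tendstoD(2)) (rule A(2))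
  then obtain n where "prob (U n - A) < e"
    by (auto simp: eventually_sequentially)
  then show ?thesis
    using that \<open>open (U n)\<close> \<open>A \<subseteq> U n\<close> by blast
qed

text \<open>The regularity theorem of the library requires a Polish space as the type, whereas here the
  type is only a metric space.\<close>

lemma closed_open_approximation:
  assumes "A \<in> sets borel" "0 < e"
  shows "\<exists>K U. closed K \<and> open U \<and> K \<subseteq> A \<and> A \<subseteq> U \<and> prob (U - K) < e"
proof -
  have "A \<in> sigma_sets UNIV (Collect closed)"
    using assms(1) by (simp add: borel_eq_closed)
  then show ?thesis
    using assms(2)
  proof (induction arbitrary: e rule: sigma_sets.induct)
    case (Basic A)
    then show ?case
      using closed_outer_approximation[of A e] by (metis mem_Collect_eq order_refl)
  next
    case Empty
    then show ?case
      by (intro exI[of _ "{}"]) auto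
  next
    case (Compl A)
    from Compl.IH[OF Compl.prems] obtain K U
      where KU: "closed K" "open U" "K \<subseteq> A" "A \<subseteq> U" "prob (U - K) < e"
      by blast
    \<comment> \<open>Complements exchange the inner and the outer set without changing the
      gap.\<close>
    have "- K - - U = U - K" by auto
    then have "closed (- U)" "open (- K)" "- U \<subseteq> UNIV - A" "UNIV - A \<subseteq> - K" "prob (- K - - U) < e"
      using KU by auto
    then show ?case by blast
  next
    case (Union A)
    \<comment> \<open>The tolerances sum to \<open>e / 2\<close>, leaving room to replace the
      infinite union of inner sets by a finite one.\<close>
    have "\<exists>K U. closed K \<and> open U \<and> K \<subseteq> A i \<and> A i \<subseteq> U \<and> prob (U - K) < e / 2 * (1 / 2) ^ Suc i" for i
      using Union.IH[of "e / 2 * (1 / 2) ^ Suc i" i] Union.prems by simp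
    then obtain K U where KU: "\<And>i. closed (K i)" "\<And>i. open (U i)" "\<And>i. K i \<subseteq> A i" "\<And>i. A i \<subseteq> U i"
      "\<And>i. prob (U i - K i) < e / 2 * (1 / 2) ^ Suc i"
      by metis
    have [measurable]: "K i \<in> sets borel" "U i \<in> sets borel" for i
      using KU(1,2) by (auto intro: borel_open borel_closed)
    have geometric: "(\<lambda>i. e / 2 * (1 / 2) ^ Suc i) sums (e / 2)"
      using sums_mult[OF power_half_series, of "e / 2"] by simp
    have summable: "summable (\<lambda>i. prob (U i - K i))"
      by (rule summable_comparison_test'[OF sums_summable[OF geometric], of 0])
        (use KU(5) in \<open>auto intro: less_imp_le\<close>)
    \<comment> \<open>An infinite union of closed sets need not be closed. The gaps left by finite
      unions decrease to a set of measure at most \<open>e / 2\<close>.\<close>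
    define D where "D n = (\<Union>i. U i) - (\<Union>i<n. K i)" for n
    have "(\<lambda>n. prob (D n)) \<longlonglongrightarrow> prob (\<Inter>n. D n)"
      by (rule finite_Lim_measure_decseq) (auto simp: D_def decseq_def)
    moreover have "prob (\<Inter>n. D n) < e"
    proof -
      have "prob (\<Inter>n. D n) \<le> prob (\<Union>i. U i - K i)"
        by (rule finite_measure_mono) (auto simp: D_def)
      also have "\<dots> \<le> (\<Sum>i. prob (U i - K i))"
        by (rule finite_measure_subadditive_countably) (use summable in auto)
      also have "\<dots> \<le> (\<Sum>i. e / 2 * (1 / 2) ^ Suc i)"
        by (rule suminf_le) (use KU(5) summable geometric in \<open>auto intro: less_imp_le sums_summable\<close>)
      also have "\<dots> = e / 2"
        using geometric by (rule sums_unique[symmetric])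
      finally show ?thesis using Union.prems by simp
    qed
    ultimately have "\<forall>\<^sub>F n in sequentially. prob (D n) < e"
      by (rule order_tendstoD(2))
    then obtain n where "prob (D n) < e"
      by (auto simp: eventually_sequentially)
    moreover have "closed (\<Union>i<n. K i)" "open (\<Union>i. U i)"
      using KU(1,2) by auto
    moreover have "(\<Union>i<n. K i) \<subseteq> (\<Union>i. A i)" "(\<Union>i. A i) \<subseteq> (\<Union>i. U i)"
      using KU(3,4) by blast+
    ultimately show ?case
      unfolding D_def by blast
  qed
qed

end

section \<open>Positive distance between disjoint compact sets\<close>

text \<open>The distance to \<open>T\<close> attains its minimum on the compact set
  \<open>S\<close>, and the minimum is positive because \<open>T\<close> is closed.\<close>

lemma compact_closed_separated:
  fixes S T :: "'a::metric_space set"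
  assumes "compact S" "closed T" "S \<inter> T = {}"
  obtains d where "0 < d" "\<And>x y. x \<in> S \<Longrightarrow> y \<in> T \<Longrightarrow> d \<le> dist x y"
proof (cases "S = {} \<or> T = {}")
  case True
  then show ?thesis using that[of 1] by auto
next
  case False
  have "continuous_on S (\<lambda>x. infdist x T)"
    by (intro continuous_intros)
  then obtain z where z: "z \<in> S" "\<And>x. x \<in> S \<Longrightarrow> infdist z T \<le> infdist x T"
    using continuous_attains_inf[OF assms(1)] False by blast
  have "0 < infdist z T"
    using z(1) assms False by (intro infdist_pos_not_in_closed) auto
  moreover have "infdist z T \<le> dist x y" if "x \<in> S" "y \<in> T" for x y
    using z(2)[OF that(1)] infdist_le[OF that(2), of x] by linarith
  ultimately show ?thesis
    using that by blast
qed

lemma disjoint_compact_family_separated: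
  fixes K :: "'i \<Rightarrow> 'a::metric_space set"
  assumes "finite I" and K: "\<And>i. i \<in> I \<Longrightarrow> compact (K i)"
    and disj: "\<And>i j. i \<in> I \<Longrightarrow> j \<in> I \<Longrightarrow> i \<noteq> j \<Longrightarrow> K i \<inter> K j = {}"
  obtains d where "0 < d"
    "\<And>i j x y. i \<in> I \<Longrightarrow> j \<in> I \<Longrightarrow> x \<in> K i \<Longrightarrow> y \<in> K j \<Longrightarrow> dist x y < d \<Longrightarrow> i = j"
proof -
  have "\<exists>d>0. \<forall>x\<in>K i. \<forall>y\<in>K j. i \<noteq> j \<longrightarrow> d \<le> dist x y" if ij: "i \<in> I" "j \<in> I" for i j
  proof (cases "i = j")
    case False
    then obtain d where "0 < d" "\<And>x y. x \<in> K i \<Longrightarrow> y \<in> K j \<Longrightarrow> d \<le> dist x y"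
      using compact_closed_separated[OF K[OF ij(1)] compact_imp_closed[OF K[OF ij(2)]] disj[OF ij False]]
      by blast
    then show ?thesis by blast
  qed (auto intro: exI[of _ 1])
  then obtain d where d: "\<And>i j. i \<in> I \<Longrightarrow> j \<in> I \<Longrightarrow> 0 < d i j"
    "\<And>i j x y. i \<in> I \<Longrightarrow> j \<in> I \<Longrightarrow> x \<in> K i \<Longrightarrow> y \<in> K j \<Longrightarrow> i \<noteq> j \<Longrightarrow> d i j \<le> dist x y"
    by metis
  \<comment> \<open>The inserted 1 keeps the minimum meaningful for empty \<open>I\<close>.\<close>
  define m where "m = Min (insert 1 ((\<lambda>(i, j). d i j) ` (I \<times> I)))"
  have fin: "finite (insert 1 ((\<lambda>(i, j). d i j) ` (I \<times> I)))"
    using assms(1) by simp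
  have "0 < m"
    unfolding m_def using fin d(1) by (subst Min_gr_iff) auto
  moreover have "m \<le> d i j" if "i \<in> I" "j \<in> I" for i j
    unfolding m_def using fin that by (intro Min_le) auto
  ultimately show ?thesis
    using d(2) by (intro that[of m]) (meson not_less order_trans)+
qed

section \<open>Entropy and Hamming distance\<close>

context coded_system
begin

definition hamming_dist :: "'b list \<Rightarrow> 'b list \<Rightarrow> nat" where
  "hamming_dist w v = card {i. i < length v \<and> w ! i \<noteq> v ! i}"

lemma hamming_dist_le_length: "hamming_dist w v \<le> length v"
  using card_mono[of "{..<length v}" "{i. i < length v \<and> w ! i \<noteq> v ! i}"]
  by (auto simp: hamming_dist_def)

lemma hamming_dist_Cons: "hamming_dist (a # w) (b # v) = (if a = b then 0 else 1) + hamming_dist w v"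
proof -
  have "{i. i < length (b # v) \<and> (a # w) ! i \<noteq> (b # v) ! i}
      = (if a = b then {} else {0}) \<union> Suc ` {i. i < length v \<and> w ! i \<noteq> v ! i}"
  proof (rule set_eqI)
    fix k
    show "k \<in> {i. i < length (b # v) \<and> (a # w) ! i \<noteq> (b # v) ! i}
        \<longleftrightarrow> k \<in> (if a = b then {} else {0}) \<union> Suc ` {i. i < length v \<and> w ! i \<noteq> v ! i}"
      by (cases k) auto
  qed
  then show ?thesis
    unfolding hamming_dist_def by (simp add: card_Un_disjoint card_image)
qed

text \<open>The sum factorises over positions: a matching letter contributes 1 and every other
  letter \<open>exp (- s)\<close>. The bound is uniform in the centre \<open>v\<close>.\<close>

lemma sum_exp_hamming_dist_le:
  "length v = n \<Longrightarrow> (\<Sum>w\<in>words n. exp (- s * real (hamming_dist w v))) \<le> (1 + alphabet_size * exp (- s)) ^ n"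
proof (induction n arbitrary: v)
  case 0
  then show ?case by (simp add: words_0 hamming_dist_def)
next
  case (Suc n)
  then obtain b u where v: "v = b # u" "length u = n"
    by (metis length_Suc_conv)
  have letters: "(\<Sum>a\<in>range c. exp (- s * real (if a = b then 0 else 1))) \<le> 1 + alphabet_size * exp (- s)"
  proof -
    have "(\<Sum>a\<in>range c. exp (- s * real (if a = b then 0 else 1)))
        \<le> (\<Sum>a\<in>range c. (if a = b then 1 else 0) + exp (- s))"
      by (intro sum_mono) auto
    also have "\<dots> \<le> 1 + alphabet_size * exp (- s)"
      using finite_range_c by (simp add: sum.distrib alphabet_size_def)
    finally show ?thesis .
  qed
  have "(\<Sum>w\<in>words (Suc n). exp (- s * real (hamming_dist w v)))
      = (\<Sum>w\<in>words n. (\<Sum>a\<in>range c. exp (- s * real (if a = b then 0 else 1))) * exp (- s * real (hamming_dist w u)))"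
    unfolding sum_words_Suc v hamming_dist_Cons sum_distrib_right
    by (intro sum.cong refl) (simp add: algebra_simps flip: exp_add)
  also have "\<dots> \<le> (\<Sum>w\<in>words n. (1 + alphabet_size * exp (- s)) * exp (- s * real (hamming_dist w u)))"
    by (intro sum_mono mult_right_mono letters) simp
  also have "\<dots> = (1 + alphabet_size * exp (- s)) * (\<Sum>w\<in>words n. exp (- s * real (hamming_dist w u)))"
    by (simp add: sum_distrib_left)
  also have "\<dots> \<le> (1 + alphabet_size * exp (- s)) * (1 + alphabet_size * exp (- s)) ^ n"
    using Suc.IH[OF v(2)] alphabet_size_ge_1 by (intro mult_left_mono) (auto intro: add_nonneg_nonneg)
  finally show ?case by simp
qed

text \<open>If the names of the points of \<open>E\<close> are \<open>k\<close>-dense in Hamming distance among the names of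
  the points of \<open>G\<close>, the Gibbs inequality with weights decaying exponentially in the Hamming distance
  to these names bounds the entropy in terms of \<open>card E\<close>.\<close>

lemma name_entropy_le_card_net:
  assumes E: "finite E" "E \<noteq> {}" and G: "G \<in> sets borel" and s: "0 < s" and k: "0 \<le> k"
    and net: "\<And>x. x \<in> G \<Longrightarrow> \<exists>e\<in>E. real (hamming_dist (name n x) (name n e)) \<le> k"
  shows "name_entropy n \<le> s * k + s * real n * (1 - prob G) + ln (real (card E))
    + real n * (alphabet_size * exp (- s))"
proof -
  define W where "W w = (\<Sum>e\<in>E. exp (- s * real (hamming_dist w (name n e))))" for w
  have W_ge: "exp (- s * real (hamming_dist w (name n e))) \<le> W w" if "e \<in> E" for e w
    unfolding W_def by (rule member_le_sum) (use that E in auto)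
  have W_pos: "0 < W w" for w
    unfolding W_def using E by (intro sum_pos) auto
  \<comment> \<open>On \<open>G\<close> one nearby net point already makes the weight at least
    \<open>exp (- s * k)\<close>. Elsewhere the trivial Hamming bound \<open>n\<close> is used,
    which later produces the term with \<open>1 - prob G\<close>.\<close>
  have point: "- ln (W (name n x)) \<le> s * k + s * real n * indicator (- G) x" for x
  proof -
    obtain e where e: "e \<in> E" "real (hamming_dist (name n x) (name n e)) \<le> k + real n * indicator (- G) x"
    proof (cases "x \<in> G")
      case True
      then show ?thesis using net[OF True] that by auto
    next
      case False
      obtain e where "e \<in> E" using E by blast
      moreover have "real (hamming_dist (name n x) (name n e)) \<le> real n"
        using hamming_dist_le_length[of "name n x" "name n e"] by simp
      ultimately show ?thesis using that[of e] False k by simp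
    qed
    have "- s * real (hamming_dist (name n x) (name n e)) \<le> ln (W (name n x))"
      using W_ge[OF e(1), of "name n x"] W_pos by (metis ln_exp ln_le_cancel_iff exp_gt_zero)
    moreover have "s * real (hamming_dist (name n x) (name n e)) \<le> s * (k + real n * indicator (- G) x)"
      using e(2) s by (intro mult_left_mono) auto
    ultimately show ?thesis by (simp add: algebra_simps)
  qed
  have [measurable]: "G \<in> sets borel" by (rule G)
  have int: "integrable \<mu> (\<lambda>x. s * real n * indicator (- G) x)"
    by (intro integrable_mult_right integrable_real_indicator) (auto simp: emeasure_eq_measure)
  have "(\<integral>x. - ln (W (name n x)) \<partial>\<mu>) \<le> (\<integral>x. s * k + s * real n * indicator (- G) x \<partial>\<mu>)"
  proof (rule integral_mono[OF _ _ point])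
    show "integrable \<mu> (\<lambda>x. - ln (W (name n x)))"
      by (rule integrable_comp_name[of "\<lambda>w. - ln (W w)"])
    show "integrable \<mu> (\<lambda>x. s * k + s * real n * indicator (- G) x)"
      using int by simp
  qed
  also have "\<dots> = s * k + s * real n * (1 - prob G)"
  proof -
    have "prob (- G) = 1 - prob G"
      using prob_compl[of G] by (simp add: Compl_eq_Diff_UNIV)
    then show ?thesis
      using int by (subst Bochner_Integration.integral_add) auto
  qed
  finally have integral: "(\<integral>x. - ln (W (name n x)) \<partial>\<mu>) \<le> s * k + s * real n * (1 - prob G)" .
  have q: "0 < 1 + alphabet_size * exp (- s)"
    using alphabet_size_ge_1 by (intro add_pos_nonneg) auto
  have card: "0 < card E"
    using E by (simp add: card_gt_0_iff)
  \<comment> \<open>Swapping the sums leaves one exponential moment per net point, so the total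
    weight is \<open>card E\<close> up to a factor of small growth rate.\<close>
  have "sum W (words n) = (\<Sum>e\<in>E. \<Sum>w\<in>words n. exp (- s * real (hamming_dist w (name n e))))"
    unfolding W_def by (rule sum.swap)
  also have "\<dots> \<le> (\<Sum>e\<in>E. (1 + alphabet_size * exp (- s)) ^ n)"
    by (intro sum_mono sum_exp_hamming_dist_le) simp
  finally have "sum W (words n) \<le> real (card E) * (1 + alphabet_size * exp (- s)) ^ n"
    by simp
  moreover have "0 < sum W (words n)"
  proof (rule sum_pos)
    show "words n \<noteq> {}" using name_in_words by blast
  qed (use W_pos in auto)
  ultimately have "ln (sum W (words n)) \<le> ln (real (card E) * (1 + alphabet_size * exp (- s)) ^ n)"
    by simp
  also have "\<dots> = ln (real (card E)) + real n * ln (1 + alphabet_size * exp (- s))"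
    using q card by (simp add: ln_mult ln_realpow)
  also have "\<dots> \<le> ln (real (card E)) + real n * (alphabet_size * exp (- s))"
    using q alphabet_size_ge_1 by (intro add_left_mono mult_left_mono ln_add_one_self_le_self) auto
  finally show ?thesis
    using name_entropy_gibbs[of n W] W_pos integral by (force simp: less_imp_le)
qed

end

section \<open>Generic points and maximal separated sets\<close>

text \<open>Dominated convergence of the indicators turns eventual membership of almost every point
  into high probability at each large time.\<close>

lemma (in invariant_system) prob_LIMSEQ_1:
  assumes [measurable]: "\<And>n. G n \<in> sets borel" and AE: "AE x in \<mu>. \<forall>\<^sub>F n in sequentially. x \<in> G n"
  shows "(\<lambda>n. prob (G n)) \<longlonglongrightarrow> 1"
proof -
  have "(\<lambda>n. \<integral>x. indicator (G n) x \<partial>\<mu>) \<longlonglongrightarrow> (\<integral>x. (1::real) \<partial>\<mu>)"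
  proof (rule integral_dominated_convergence[where w = "\<lambda>_. 1"])
    show "AE x in \<mu>. (\<lambda>n. indicator (G n) x) \<longlonglongrightarrow> (1::real)"
      using AE
    proof eventually_elim
      case (elim x)
      then have "\<forall>\<^sub>F n in sequentially. indicator (G n) x = (1::real)"
        by eventually_elim simp
      then show ?case by (rule tendsto_eventually)
    qed
    show "AE x in \<mu>. norm (indicator (G n) x :: real) \<le> 1" for n
      by (simp add: indicator_def)
  qed auto
  then show ?thesis by simp
qed

text \<open>As \<open>G\<close> may be infinite, a maximal separated set is sought among finitely
  many representatives, one per realised name. This suffices because the Hamming estimate depends
  only on names.\<close>

lemma (in coded_system) delta_separated_net:
  assumes "G \<noteq> {}" and \<delta>: "0 \<le> \<delta>" and \<epsilon>: "0 \<le> \<epsilon>"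
  obtains E where "finite E" "E \<noteq> {}" "E \<subseteq> G" "delta_separated f \<delta> n \<epsilon> E"
    "\<And>x. x \<in> G \<Longrightarrow> \<exists>r\<in>G. name n r = name n x \<and>
      (\<exists>e\<in>E. real (card {j. j < n \<and> dist ((f ^^ j) r) ((f ^^ j) e) > \<epsilon>}) \<le> \<delta> * real n)"
proof -
  define rep where "rep w = (SOME x. x \<in> G \<and> name n x = w)" for w
  have rep: "rep (name n x) \<in> G \<and> name n (rep (name n x)) = name n x" if "x \<in> G" for x
    unfolding rep_def by (rule someI[of _ x]) (use that in simp)
  define R where "R = rep ` name n ` G"
  have R: "R \<subseteq> G" "R \<noteq> {}"
    unfolding R_def using rep assms(1) by auto
  have "finite R"
    unfolding R_def by (intro finite_imageI finite_subset[OF _ finite_words[of n]]) auto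
  define S where "S = {E. E \<subseteq> R \<and> delta_separated f \<delta> n \<epsilon> E}"
  have "finite S"
    unfolding S_def using \<open>finite R\<close> by simp
  moreover have "{} \<in> S"
    by (simp add: S_def delta_separated_def)
  ultimately obtain E where E: "E \<in> S" and max: "\<And>E'. E' \<in> S \<Longrightarrow> E \<subseteq> E' \<Longrightarrow> E = E'"
    using finite_has_maximal[of S] by blast
  have "E \<noteq> {}"
  proof
    assume "E = {}"
    obtain r where "r \<in> R" using R(2) by blast
    then have "{r} \<in> S" by (simp add: S_def delta_separated_def)
    with max[of "{r}"] \<open>E = {}\<close> show False by blast
  qed
  moreover have "\<exists>e\<in>E. real (card {j. j < n \<and> dist ((f ^^ j) r) ((f ^^ j) e) > \<epsilon>}) \<le> \<delta> * real n"
    if r: "r \<in> R" for r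
  proof (rule ccontr)
    \<comment> \<open>A point far from all of \<open>E\<close> could be added to it. It is not
      already in \<open>E\<close>, since its distance to itself never exceeds
      \<open>\<epsilon>\<close>.\<close>
    assume far: "\<not> ?thesis"
    have "r \<notin> E"
    proof
      assume "r \<in> E"
      moreover have "{j. j < n \<and> dist ((f ^^ j) r) ((f ^^ j) r) > \<epsilon>} = {}"
        using \<epsilon> by auto
      then have "real (card {j. j < n \<and> dist ((f ^^ j) r) ((f ^^ j) r) > \<epsilon>}) \<le> \<delta> * real n"
        using \<delta> by (simp only: card.empty of_nat_0 mult_nonneg_nonneg of_nat_0_le_iff)
      ultimately show False using far by blast
    qed
    have far': "\<delta> * real n \<le> real (card {j. j < n \<and> dist ((f ^^ j) r) ((f ^^ j) e) > \<epsilon>})"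
      "\<delta> * real n \<le> real (card {j. j < n \<and> dist ((f ^^ j) e) ((f ^^ j) r) > \<epsilon>})" if "e \<in> E" for e
      using far that by (force simp: dist_commute)+
    have "insert r E \<in> S"
      using E r far' unfolding S_def delta_separated_def by auto
    with max[of "insert r E"] \<open>r \<notin> E\<close> show False by blast
  qed
  moreover have "E \<subseteq> R" "delta_separated f \<delta> n \<epsilon> E"
    using E by (auto simp: S_def)
  moreover have "\<exists>r\<in>R. name n r = name n x" if "x \<in> G" for x
    using rep[OF that] that unfolding R_def by blast
  ultimately show ?thesis
    using R(1) \<open>finite R\<close> by (intro that[of E]) (auto dest: finite_subset, meson subsetD)
qed

text \<open>\<open>\<epsilon>\<close> and \<open>\<delta>\<close> are chosen from
  \<open>\<xi>\<close> and \<open>\<eta>\<close> alone, before \<open>F\<close>, because the infimum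
  over neighbourhoods lies inside both suprema.\<close>

lemma (in ergodic_system) liminf_P_delta_sep_ge_partition:
  assumes compact: "compact (UNIV :: 'a set)" and \<phi>: "continuous_on UNIV \<phi>"
    and \<xi>: "finite_borel_partition \<xi>" and "0 < \<eta>"
  obtains \<epsilon> \<delta> where "0 < \<epsilon>" "0 < \<delta>"
    "\<And>F. F \<in> nbhds_of \<mu> \<Longrightarrow> ereal (entropy_wrt_partition \<mu> f \<xi> + (\<integral>x. \<phi> x \<partial>\<mu>) - 8 * \<eta>)
      \<le> liminf (\<lambda>n. ereal (1 / real n) * ext_ln (P_delta_sep f F \<phi> \<delta> n \<epsilon>))"
proof -
  interpret coded_system f \<mu> "cell \<xi>"
    by (rule coded_system_cell[OF \<xi>])
  have part: "partition_on UNIV \<xi>" "finite \<xi>" "\<And>A. A \<in> \<xi> \<Longrightarrow> A \<in> sets borel"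
    using \<xi> by (auto simp: finite_borel_partition_def)
  have rate: "entropy_rate = entropy_wrt_partition \<mu> f \<xi>"
    using entropy_wrt_partition_eq[OF coded_system_axioms part(1)] by simp
  \<comment> \<open>Each Hamming error costs \<open>s\<close> in the Gibbs bound. A large
    \<open>s\<close> makes the growth rate of the total weight per net point at most
    \<open>\<eta>\<close>, and the error frequency \<open>\<theta>\<close> is then scaled so that
    \<open>s * \<theta> = \<eta>\<close>.\<close>
  define s where "s = max 1 (ln (alphabet_size / \<eta>))"
  have s: "0 < s" by (simp add: s_def)
  have L: "0 < alphabet_size" using alphabet_size_ge_1 by linarith
  have "exp (- s) \<le> exp (- ln (alphabet_size / \<eta>))"
    by (simp add: s_def)
  also have "\<dots> = \<eta> / alphabet_size"
    using L \<open>0 < \<eta>\<close> by (simp add: exp_minus)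
  finally have small: "alphabet_size * exp (- s) \<le> \<eta>"
    using L by (simp add: field_simps)
  define \<theta> where "\<theta> = \<eta> / s"
  have \<theta>: "0 < \<theta>" "s * \<theta> = \<eta>"
    using s \<open>0 < \<eta>\<close> by (auto simp: \<theta>_def)
  have card: "0 < card \<xi>"
    using part(1,2) partition_onD1[OF part(1)] by (auto simp: card_gt_0_iff)
  \<comment> \<open>The closed inner sets are compact, hence those of different cells lie at
    positive distance, and the discarded parts have total measure at most
    \<open>\<theta>\<close>.\<close>
  have "\<exists>K. closed K \<and> K \<subseteq> A \<and> prob (A - K) < \<theta> / real (card \<xi>)" if A: "A \<in> \<xi>" for A
  proof -
    obtain K U where KU: "closed K" "open U" "K \<subseteq> A" "A \<subseteq> U" "prob (U - K) < \<theta> / real (card \<xi>)"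
      using closed_open_approximation[OF part(3)[OF A], of "\<theta> / real (card \<xi>)"] \<theta>(1) card by auto
    have "U - K \<in> sets borel"
      using KU(1,2) by (intro borel_open open_Diff)
    then have "prob (A - K) \<le> prob (U - K)"
      using KU(4) by (intro finite_measure_mono) auto
    with KU show ?thesis by (meson le_less_trans)
  qed
  then obtain K where K: "\<And>A. A \<in> \<xi> \<Longrightarrow> closed (K A)" "\<And>A. A \<in> \<xi> \<Longrightarrow> K A \<subseteq> A"
    "\<And>A. A \<in> \<xi> \<Longrightarrow> prob (A - K A) < \<theta> / real (card \<xi>)"
    by metis
  obtain d where d: "0 < d"
    "\<And>A B x y. A \<in> \<xi> \<Longrightarrow> B \<in> \<xi> \<Longrightarrow> x \<in> K A \<Longrightarrow> y \<in> K B \<Longrightarrow> dist x y < d \<Longrightarrow> A = B"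
  proof (rule disjoint_compact_family_separated[of \<xi> K])
    show "compact (K A)" if "A \<in> \<xi>" for A
      using closed_Int_compact[OF K(1)[OF that] compact] by simp
    show "K A \<inter> K B = {}" if "A \<in> \<xi>" "B \<in> \<xi>" "A \<noteq> B" for A B
      using K(2)[OF that(1)] K(2)[OF that(2)] disjointD[OF partition_onD2[OF part(1)] that] by blast
  qed (use part(2) in auto)
  define bad where "bad = (\<Union>A\<in>\<xi>. A - K A)"
  have diff [measurable]: "A - K A \<in> sets borel" if "A \<in> \<xi>" for A
    by (rule sets.Diff[OF part(3)[OF that] borel_closed[OF K(1)[OF that]]])
  have bad_meas [measurable]: "bad \<in> sets borel"
    unfolding bad_def using part(2) diff by (intro sets.finite_UN) auto
  have "prob bad \<le> (\<Sum>A\<in>\<xi>. prob (A - K A))"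
    unfolding bad_def using part(2) diff by (intro finite_measure_subadditive_finite) auto
  also have "\<dots> \<le> (\<Sum>A\<in>\<xi>. \<theta> / real (card \<xi>))"
    by (intro sum_mono less_imp_le K(3))
  also have "\<dots> = \<theta>"
    using card by simp
  finally have bad_prob: "prob bad \<le> \<theta>" .
  \<comment> \<open>Consequently two names disagree only at times when the orbits are more than
    \<open>d / 2\<close> apart or one of them visits \<open>bad\<close>.\<close>
  have same_cell: "cell \<xi> x = cell \<xi> y" if "dist x y \<le> d / 2" "x \<notin> bad" "y \<notin> bad" for x y
  proof (rule d(2))
    show "x \<in> K (cell \<xi> x)" "y \<in> K (cell \<xi> y)"
      using that(2,3) cell_in[OF part(1)] self_in_cell[OF part(1)] unfolding bad_def by blast+
  qed (use that(1) d(1) cell_in[OF part(1)] in auto)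
  have "ereal (entropy_wrt_partition \<mu> f \<xi> + (\<integral>x. \<phi> x \<partial>\<mu>) - 8 * \<eta>)
      \<le> liminf (\<lambda>n. ereal (1 / real n) * ext_ln (P_delta_sep f F \<phi> \<theta> n (d / 2)))"
    if F: "F \<in> nbhds_of \<mu>" for F
  proof -
    obtain \<G> :: "('a \<Rightarrow> real) set" and e where \<G>: "finite \<G>" "0 < e" "\<And>g. g \<in> \<G> \<Longrightarrow> continuous_on UNIV g"
      "\<And>\<nu>. \<nu> \<in> borel_probs \<Longrightarrow> (\<And>g. g \<in> \<G> \<Longrightarrow> \<bar>(\<integral>x. g x \<partial>\<nu>) - (\<integral>x. g x \<partial>\<mu>)\<bar> < e) \<Longrightarrow> \<nu> \<in> F"
      using weak_star_nbhd_basic[OF F] by metis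
    \<comment> \<open>\<open>\<phi>\<close> joins the test functions so that good points also have
      nearly the expected Birkhoff sum of \<open>\<phi>\<close>.\<close>
    define \<Phi> where "\<Phi> = insert \<phi> \<G>"
    have \<Phi>: "finite \<Phi>" "\<And>g. g \<in> \<Phi> \<Longrightarrow> continuous_on UNIV g"
      using \<G> \<phi> by (auto simp: \<Phi>_def)
    have \<Phi>_meas: "g \<in> borel_measurable borel" if "g \<in> \<Phi>" for g
      using \<Phi>(2)[OF that] by (rule borel_measurable_continuous_onI)
    define close where "close n = {x. \<forall>g\<in>\<Phi>. \<bar>birkhoff_sum f g n x / real n - (\<integral>x. g x \<partial>\<mu>)\<bar> < min e \<eta>}" for n
    \<comment> \<open>The bound \<open>2 * \<theta>\<close> allows \<open>\<theta>\<close> for the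
      measure of \<open>bad\<close> and \<open>\<theta>\<close> for the tolerance in the ergodic
      theorem.\<close>
    define rare where "rare n = {x. birkhoff_sum f (indicator bad) n x / real n < 2 * \<theta>}" for n
    define good where "good n = close n \<inter> rare n" for n
    have good_meas: "good n \<in> sets borel" for n
    proof -
      have [measurable]: "birkhoff_sum f g n \<in> borel_measurable borel"
        if [measurable]: "g \<in> borel_measurable borel" for g
        unfolding birkhoff_sum_def by measurable
      have one: "{x. \<bar>birkhoff_sum f g n x / real n - (\<integral>x. g x \<partial>\<mu>)\<bar> < min e \<eta>} \<in> sets borel" if "g \<in> \<Phi>" for g
        using \<Phi>_meas[OF that] by measurable
      have "(\<Inter>g\<in>\<Phi>. {x. \<bar>birkhoff_sum f g n x / real n - (\<integral>x. g x \<partial>\<mu>)\<bar> < min e \<eta>}) \<in> sets borel"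
      proof (rule sets.finite_INT[OF \<Phi>(1) _ one])
        show "\<Phi> \<noteq> {}" by (simp add: \<Phi>_def)
      qed
      moreover have "close n = (\<Inter>g\<in>\<Phi>. {x. \<bar>birkhoff_sum f g n x / real n - (\<integral>x. g x \<partial>\<mu>)\<bar> < min e \<eta>})"
        by (auto simp: close_def)
      moreover have "rare n \<in> sets borel"
        unfolding rare_def by measurable
      ultimately show ?thesis by (simp add: good_def)
    qed
    have "AE x in \<mu>. \<forall>g\<in>\<Phi>. \<forall>\<^sub>F n in sequentially. \<bar>birkhoff_sum f g n x / real n - (\<integral>x. g x \<partial>\<mu>)\<bar> < min e \<eta>"
    proof (rule AE_finite_allI[OF \<Phi>(1)])
      fix g assume g: "g \<in> \<Phi>"
      have "bounded (range g)"
        using compact_continuous_image[OF \<Phi>(2)[OF g] compact] by (rule compact_imp_bounded)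
      then obtain B where "\<And>x. \<bar>g x\<bar> \<le> B"
        by (auto simp: bounded_iff)
      then show "AE x in \<mu>. \<forall>\<^sub>F n in sequentially. \<bar>birkhoff_sum f g n x / real n - (\<integral>x. g x \<partial>\<mu>)\<bar> < min e \<eta>"
        using \<G>(2) \<open>0 < \<eta>\<close> by (intro birkhoff_average_AE_close[OF \<Phi>_meas[OF g]]) auto
    qed
    moreover have "AE x in \<mu>. \<forall>\<^sub>F n in sequentially.
        birkhoff_sum f (indicator bad) n x / real n < (\<integral>x. indicator bad x \<partial>\<mu>) + \<theta>"
      by (rule birkhoff_average_AE_less[where B = 1]) (use \<theta>(1) in \<open>auto simp: indicator_def\<close>)
    ultimately have "AE x in \<mu>. \<forall>\<^sub>F n in sequentially. x \<in> good n"
    proof eventually_elim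
      case (elim x)
      have "\<forall>\<^sub>F n in sequentially. \<forall>g\<in>\<Phi>. \<bar>birkhoff_sum f g n x / real n - (\<integral>x. g x \<partial>\<mu>)\<bar> < min e \<eta>"
        using elim(1) \<Phi>(1) by (intro eventually_ball_finite) auto
      with elim(2) show ?case
      proof eventually_elim
        case (elim n)
        have "(\<integral>x. indicator bad x \<partial>\<mu>) = prob bad" by simp
        with elim(1) bad_prob have "x \<in> rare n" unfolding rare_def by simp
        with elim(2) show ?case by (simp add: good_def close_def)
      qed
    qed
    then have "(\<lambda>n. prob (good n)) \<longlonglongrightarrow> 1"
      by (intro prob_LIMSEQ_1 good_meas)
    \<comment> \<open>The entry \<open>1 / 2\<close> keeps \<open>good n\<close> nonempty even if
      \<open>\<theta>\<close> exceeds 1.\<close>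
    then have large: "\<forall>\<^sub>F n in sequentially. max (1 / 2) (1 - \<theta>) < prob (good n)"
      by (rule order_tendstoD(1)) (use \<theta>(1) in simp)
    \<comment> \<open>The loss \<open>8 * \<eta>\<close> consists of five for Hamming errors, one
      for points outside \<open>good n\<close>, one for the growth of the total weight per net
      point, and one for \<open>\<phi>\<close>.\<close>
    define a where "a n = name_entropy n / real n + ((\<integral>x. \<phi> x \<partial>\<mu>) - 8 * \<eta>)" for n
    have lower: "ereal (a n) \<le> ereal (1 / real n) * ext_ln (P_delta_sep f F \<phi> \<theta> n (d / 2))"
      if n: "0 < n" and good_prob: "max (1 / 2) (1 - \<theta>) < prob (good n)" for n
    proof -
      have "good n \<noteq> {}"
        using good_prob by auto
      then obtain E where E: "finite E" "E \<noteq> {}" "E \<subseteq> good n" "delta_separated f \<theta> n (d / 2) E"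
        and net: "\<And>x. x \<in> good n \<Longrightarrow> \<exists>r\<in>good n. name n r = name n x \<and>
          (\<exists>e\<in>E. real (card {j. j < n \<and> dist ((f ^^ j) r) ((f ^^ j) e) > d / 2}) \<le> \<theta> * real n)"
        using delta_separated_net[of "good n" \<theta> "d / 2" n] \<theta>(1) d(1) by auto
      have rare: "real (card {j. j < n \<and> (f ^^ j) x \<in> bad}) \<le> 2 * \<theta> * real n" if "x \<in> good n" for x
      proof -
        have "birkhoff_sum f (indicator bad) n x = real (card {j. j < n \<and> (f ^^ j) x \<in> bad})"
        proof -
          have "{..<n} \<inter> {j. (f ^^ j) x \<in> bad} = {j. j < n \<and> (f ^^ j) x \<in> bad}" by auto
          then show ?thesis
            by (simp add: birkhoff_sum_def indicator_def sum.If_cases)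
        qed
        moreover have "birkhoff_sum f (indicator bad) n x / real n < 2 * \<theta>"
          using that by (simp add: good_def rare_def)
        ultimately show ?thesis
          using n by (simp add: field_simps)
      qed
      \<comment> \<open>One \<open>\<theta>\<close> accounts for times when the orbits are far
        apart, and two each for visits of \<open>r\<close> and of \<open>e\<close> to
        \<open>bad\<close>.\<close>
      have "\<exists>e\<in>E. real (hamming_dist (name n x) (name n e)) \<le> 5 * \<theta> * real n" if x: "x \<in> good n" for x
      proof -
        obtain r e where r: "r \<in> good n" "name n r = name n x" and e: "e \<in> E"
          "real (card {j. j < n \<and> dist ((f ^^ j) r) ((f ^^ j) e) > d / 2}) \<le> \<theta> * real n"
          using net[OF x] by blast
        let ?D = "{j. j < n \<and> dist ((f ^^ j) r) ((f ^^ j) e) > d / 2}"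
        let ?B = "\<lambda>x. {j. j < n \<and> (f ^^ j) x \<in> bad}"
        have "{j. j < length (name n e) \<and> name n r ! j \<noteq> name n e ! j} \<subseteq> ?D \<union> (?B r \<union> ?B e)"
        proof
          fix j assume "j \<in> {j. j < length (name n e) \<and> name n r ! j \<noteq> name n e ! j}"
          then have j: "j < n" "cell \<xi> ((f ^^ j) r) \<noteq> cell \<xi> ((f ^^ j) e)" by auto
          then have "d / 2 < dist ((f ^^ j) r) ((f ^^ j) e) \<or> (f ^^ j) r \<in> bad \<or> (f ^^ j) e \<in> bad"
            using same_cell not_le by blast
          with j(1) show "j \<in> ?D \<union> (?B r \<union> ?B e)" by blast
        qed
        then have "hamming_dist (name n r) (name n e) \<le> card (?D \<union> (?B r \<union> ?B e))"
          unfolding hamming_dist_def by (intro card_mono) auto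
        also have "\<dots> \<le> card ?D + (card (?B r) + card (?B e))"
          by (meson add_left_mono card_Un_le order_trans)
        finally have "real (hamming_dist (name n r) (name n e))
            \<le> real (card ?D) + (real (card (?B r)) + real (card (?B e)))"
          by linarith
        also have "\<dots> \<le> \<theta> * real n + (2 * \<theta> * real n + 2 * \<theta> * real n)"
          using e(2) rare[OF r(1)] rare[of e] e(1) E(3) by (intro add_mono) auto
        finally show ?thesis
          using e(1) r(2) by (intro bexI[of _ e]) auto
      qed
      then have "name_entropy n \<le> s * (5 * \<theta> * real n) + s * real n * (1 - prob (good n)) + ln (real (card E))
          + real n * (alphabet_size * exp (- s))"
        using \<theta>(1) by (intro name_entropy_le_card_net[OF E(1,2) good_meas s]) auto
      also have "\<dots> \<le> real n * (5 * \<eta>) + real n * \<eta> + ln (real (card E)) + real n * \<eta>"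
      proof (intro add_mono order_refl)
        show "s * (5 * \<theta> * real n) \<le> real n * (5 * \<eta>)"
          unfolding \<theta>(2)[symmetric] by (simp add: algebra_simps)
        have "s * real n * (1 - prob (good n)) \<le> s * real n * \<theta>"
          using good_prob s by (intro mult_left_mono) auto
        also have "\<dots> = real n * \<eta>"
          unfolding \<theta>(2)[symmetric] by (simp only: mult_ac)
        finally show "s * real n * (1 - prob (good n)) \<le> real n * \<eta>" .
        show "real n * (alphabet_size * exp (- s)) \<le> real n * \<eta>"
          by (intro mult_left_mono small) simp
      qed
      finally have entropy: "name_entropy n - real n * (7 * \<eta>) \<le> ln (real (card E))"
        by (simp add: algebra_simps)
      have "0 < card E"
        using E(1,2) by (simp add: card_gt_0_iff)
      have in_F: "E \<subseteq> empirical_in f n F"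
      proof
        fix x assume "x \<in> E"
        then have x: "x \<in> close n" using E(3) by (auto simp: good_def)
        have "\<bar>(\<integral>y. g y \<partial>empirical_measure f n x) - (\<integral>y. g y \<partial>\<mu>)\<bar> < e" if "g \<in> \<G>" for g
          using x that integral_empirical_measure[OF n \<G>(3)[OF that], of f x]
          by (simp add: close_def \<Phi>_def)
        then show "x \<in> empirical_in f n F"
          unfolding empirical_in_def using \<G>(4)[OF empirical_measure_in_borel_probs[OF n]] by blast
      qed
      have "ennreal (real (card E) * exp (real n * ((\<integral>x. \<phi> x \<partial>\<mu>) - \<eta>)))
          \<le> (\<Sum>x\<in>E. ennreal (exp (birkhoff_sum f \<phi> n x)))"
      proof -
        have "exp (real n * ((\<integral>x. \<phi> x \<partial>\<mu>) - \<eta>)) \<le> exp (birkhoff_sum f \<phi> n x)" if "x \<in> E" for x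
        proof -
          have "\<bar>birkhoff_sum f \<phi> n x / real n - (\<integral>x. \<phi> x \<partial>\<mu>)\<bar> < \<eta>"
            using that E(3) by (auto simp: good_def close_def \<Phi>_def)
          then have "(\<integral>x. \<phi> x \<partial>\<mu>) - \<eta> \<le> birkhoff_sum f \<phi> n x / real n" by linarith
          then show ?thesis using n by (simp add: field_simps)
        qed
        then have "(\<Sum>x\<in>E. exp (real n * ((\<integral>x. \<phi> x \<partial>\<mu>) - \<eta>))) \<le> (\<Sum>x\<in>E. exp (birkhoff_sum f \<phi> n x))"
          by (intro sum_mono)
        then show ?thesis
          by (simp add: ennreal_leI)
      qed
      also have "\<dots> \<le> P_delta_sep f F \<phi> \<theta> n (d / 2)"
        unfolding P_delta_sep_def by (rule SUP_upper) (use E(1,4) in_F in simp)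
      finally have "ereal (ln (real (card E) * exp (real n * ((\<integral>x. \<phi> x \<partial>\<mu>) - \<eta>))))
          \<le> ext_ln (P_delta_sep f F \<phi> \<theta> n (d / 2))"
        using \<open>0 < card E\<close> by (subst ext_ln_ennreal[symmetric]) (auto intro: ext_ln_mono)
      moreover have "real n * a n \<le> ln (real (card E) * exp (real n * ((\<integral>x. \<phi> x \<partial>\<mu>) - \<eta>)))"
      proof -
        have "real n * a n = name_entropy n + real n * ((\<integral>x. \<phi> x \<partial>\<mu>) - 8 * \<eta>)"
          using n by (simp add: a_def field_simps)
        also have "\<dots> \<le> ln (real (card E)) + real n * ((\<integral>x. \<phi> x \<partial>\<mu>) - \<eta>)"
          using entropy by (simp add: algebra_simps)
        finally show ?thesis
          using \<open>0 < card E\<close> by (simp add: ln_mult)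
      qed
      ultimately have "ereal (real n * a n) \<le> ext_ln (P_delta_sep f F \<phi> \<theta> n (d / 2))"
        by (meson ereal_less_eq(3) order_trans)
      then have "ereal (1 / real n) * ereal (real n * a n)
          \<le> ereal (1 / real n) * ext_ln (P_delta_sep f F \<phi> \<theta> n (d / 2))"
        by (rule ereal_mult_left_mono) simp
      then show ?thesis using n by simp
    qed
    have "liminf (\<lambda>n. ereal (a n)) = ereal (entropy_wrt_partition \<mu> f \<xi> + (\<integral>x. \<phi> x \<partial>\<mu>) - 8 * \<eta>)"
    proof (rule lim_imp_Liminf)
      have "a \<longlonglongrightarrow> entropy_rate + ((\<integral>x. \<phi> x \<partial>\<mu>) - 8 * \<eta>)"
        unfolding a_def by (intro tendsto_add entropy_rate_LIMSEQ tendsto_const)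
      then show "(\<lambda>n. ereal (a n)) \<longlonglongrightarrow> ereal (entropy_wrt_partition \<mu> f \<xi> + (\<integral>x. \<phi> x \<partial>\<mu>) - 8 * \<eta>)"
        by (simp add: rate add_diff_eq)
    qed simp
    moreover have "liminf (\<lambda>n. ereal (a n))
        \<le> liminf (\<lambda>n. ereal (1 / real n) * ext_ln (P_delta_sep f F \<phi> \<theta> n (d / 2)))"
    proof (rule Liminf_mono)
      show "\<forall>\<^sub>F n in sequentially. ereal (a n)
          \<le> ereal (1 / real n) * ext_ln (P_delta_sep f F \<phi> \<theta> n (d / 2))"
        using large eventually_gt_at_top[of 0] by eventually_elim (rule lower)
    qed
    ultimately show ?thesis by simp
  qed
  then show ?thesis
    using that[of "d / 2" \<theta>] d(1) \<theta>(1) by simp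
qed

proposition (in ergodic_system) lower_SP'_ge:
  assumes compact: "compact (UNIV :: 'a set)" and \<phi>: "continuous_on UNIV \<phi>"
  shows "KS_entropy \<mu> f + ereal (\<integral>x. \<phi> x \<partial>\<mu>) \<le> lower_SP' \<mu> f \<phi>"
proof -
  have "ereal (entropy_wrt_partition \<mu> f \<xi>) + ereal (\<integral>x. \<phi> x \<partial>\<mu>) \<le> lower_SP' \<mu> f \<phi>"
    if \<xi>: "finite_borel_partition \<xi>" for \<xi>
  proof (rule ereal_le_epsilon2)
    fix \<eta> :: real assume "0 < \<eta>"
    then have \<eta>: "0 < \<eta> / 8" by simp
    let ?l = "\<lambda>\<epsilon> \<delta>. INF F\<in>nbhds_of \<mu>. liminf (\<lambda>n. ereal (1 / real n) * ext_ln (P_delta_sep f F \<phi> \<delta> n \<epsilon>))"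
    obtain \<epsilon> \<delta> where pos: "0 < \<epsilon>" "0 < \<delta>"
      and le: "\<And>F. F \<in> nbhds_of \<mu> \<Longrightarrow>
        ereal (entropy_wrt_partition \<mu> f \<xi> + (\<integral>x. \<phi> x \<partial>\<mu>) - 8 * (\<eta> / 8))
        \<le> liminf (\<lambda>n. ereal (1 / real n) * ext_ln (P_delta_sep f F \<phi> \<delta> n \<epsilon>))"
      using liminf_P_delta_sep_ge_partition[OF compact \<phi> \<xi> \<eta>] by blast
    have "ereal (entropy_wrt_partition \<mu> f \<xi> + (\<integral>x. \<phi> x \<partial>\<mu>) - \<eta>) \<le> ?l \<epsilon> \<delta>"
      by (rule INF_greatest) (use le in simp)
    also have "\<dots> \<le> (SUP \<delta>\<in>{0<..}. ?l \<epsilon> \<delta>)"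
      by (rule SUP_upper) (use pos in simp)
    also have "\<dots> \<le> (SUP \<epsilon>\<in>{0<..}. SUP \<delta>\<in>{0<..}. ?l \<epsilon> \<delta>)"
      by (rule SUP_upper[where f = "\<lambda>\<epsilon>. SUP \<delta>\<in>{0<..}. ?l \<epsilon> \<delta>"]) (use pos in simp)
    also have "\<dots> = lower_SP' \<mu> f \<phi>"
      by (rule SP'_eq_SUP(2)[symmetric])
    finally have "ereal (entropy_wrt_partition \<mu> f \<xi> + (\<integral>x. \<phi> x \<partial>\<mu>) - \<eta>) + ereal \<eta>
        \<le> lower_SP' \<mu> f \<phi> + ereal \<eta>"
      by (rule add_right_mono)
    then show "ereal (entropy_wrt_partition \<mu> f \<xi>) + ereal (\<integral>x. \<phi> x \<partial>\<mu>)
        \<le> lower_SP' \<mu> f \<phi> + ereal \<eta>"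
      by simp
  qed
  \<comment> \<open>Moving the real-valued integral to the other side allows the supremum over
    partitions to be taken, even if it is infinite.\<close>
  then have "KS_entropy \<mu> f \<le> lower_SP' \<mu> f \<phi> - ereal (\<integral>x. \<phi> x \<partial>\<mu>)"
    unfolding KS_entropy_def by (intro SUP_least) (simp add: ereal_le_minus)
  then show ?thesis
    by (simp add: ereal_le_minus)
qed

section \<open>Comparison of the pressures\<close>

lemma delta_separated_imp_separated:
  assumes "0 < \<delta>" "0 < n" "delta_separated f \<delta> n \<epsilon> E"
  shows "separated f n \<epsilon> E"
  unfolding separated_def
proof (intro ballI impI)
  fix x y assume "x \<in> E" "y \<in> E" "x \<noteq> y"
  then have "\<delta> * real n \<le> real (card {j. j < n \<and> dist ((f ^^ j) x) ((f ^^ j) y) > \<epsilon>})"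
    using assms(3) by (simp add: delta_separated_def)
  moreover have "0 < \<delta> * real n"
    using assms by simp
  ultimately have "card {j. j < n \<and> dist ((f ^^ j) x) ((f ^^ j) y) > \<epsilon>} \<noteq> 0"
    by linarith
  then have "{j. j < n \<and> dist ((f ^^ j) x) ((f ^^ j) y) > \<epsilon>} \<noteq> {}"
    by (metis card.empty)
  then obtain j where "j < n" "dist ((f ^^ j) x) ((f ^^ j) y) > \<epsilon>"
    by blast
  then show "bowen_dist f n x y > \<epsilon>"
    unfolding bowen_dist_def using assms(2) by (subst Max_gr_iff) auto
qed

lemma P_delta_sep_le_P_sep:
  assumes "0 < \<delta>" "0 < n"
  shows "P_delta_sep f F \<phi> \<delta> n \<epsilon> \<le> P_sep f F \<phi> n \<epsilon>"
  unfolding P_delta_sep_def P_sep_def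
  using delta_separated_imp_separated[OF assms] by (intro SUP_subset_mono) auto

text \<open>Only positive \<open>n\<close> are compared: there \<open>\<delta> * real n\<close> is
  positive, so at least one time separates the points. At \<open>n = 0\<close> the distance
  \<open>bowen_dist\<close> is a maximum over the empty set.\<close>

lemma eventually_P_delta_sep_le:
  assumes "0 < \<delta>"
  shows "\<forall>\<^sub>F n in sequentially. ereal (1 / real n) * ext_ln (P_delta_sep f F \<phi> \<delta> n \<epsilon>)
    \<le> ereal (1 / real n) * ext_ln (P_sep f F \<phi> n \<epsilon>)"
  using eventually_gt_at_top[of 0]
  by eventually_elim (intro ereal_mult_left_mono ext_ln_mono P_delta_sep_le_P_sep assms; simp)

lemma SP'_le_SP:
  "upper_SP' \<mu> f \<phi> \<le> upper_SP \<mu> f \<phi>" "lower_SP' \<mu> f \<phi> \<le> lower_SP \<mu> f \<phi>"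
  unfolding SP_eq_SUP SP'_eq_SUP
  by (intro SUP_mono' SUP_least INF_mono' Limsup_mono Liminf_mono eventually_P_delta_sep_le; simp)+

lemma lower_SP_le_upper_SP: "lower_SP \<mu> f \<phi> \<le> upper_SP \<mu> f \<phi>"
  unfolding SP_eq_SUP by (intro SUP_mono' INF_mono' Liminf_le_Limsup) simp

lemma lower_SP'_le_upper_SP': "lower_SP' \<mu> f \<phi> \<le> upper_SP' \<mu> f \<phi>"
  unfolding SP'_eq_SUP by (intro SUP_mono' INF_mono' Liminf_le_Limsup) simp

theorem theorem4p2:
  fixes f :: "'a::metric_space \<Rightarrow> 'a" and \<phi> :: "'a \<Rightarrow> real" and \<mu> :: "'a measure"
  assumes "compact (UNIV :: 'a set)"
    and "continuous_on UNIV f"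
    and "continuous_on UNIV \<phi>"
    and "ergodic_measure f \<mu>"
  shows "lower_SP \<mu> f \<phi> = upper_SP \<mu> f \<phi> \<and>
    lower_SP' \<mu> f \<phi> = upper_SP' \<mu> f \<phi> \<and>
    upper_SP \<mu> f \<phi> = KS_entropy \<mu> f + ereal (\<integral>x. \<phi> x \<partial>\<mu>) \<and>
    upper_SP' \<mu> f \<phi> = KS_entropy \<mu> f + ereal (\<integral>x. \<phi> x \<partial>\<mu>)"
proof -
  interpret ergodic_system f \<mu>
    by unfold_locales fact
  have "upper_SP \<mu> f \<phi> \<le> KS_entropy \<mu> f + ereal (\<integral>x. \<phi> x \<partial>\<mu>)"
    by (rule upper_SP_le) fact+
  moreover have "KS_entropy \<mu> f + ereal (\<integral>x. \<phi> x \<partial>\<mu>) \<le> lower_SP' \<mu> f \<phi>"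
    by (rule lower_SP'_ge) fact+
  \<comment> \<open>All four pressures lie between \<open>lower_SP'\<close> and
    \<open>upper_SP\<close>, and the two bounds on these force equality throughout.\<close>
  moreover note SP'_le_SP[of \<mu> f \<phi>] lower_SP_le_upper_SP[of \<mu> f \<phi>] lower_SP'_le_upper_SP'[of \<mu> f \<phi>]
  ultimately show ?thesis
    by (meson order_antisym order_trans)
qed

end
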